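(* Let $n$ be a positive integer, and let $\mathbb{Q}(i)=\{a+bi: a,b\in\mathbb{Q}\}$ carry the topology inherited from $\mathbb{C}$. (1) If $n\in\{1,2,4\}$, then $\mathrm{SL}(n,\mathbb{Q}(i))$ is totally minimal. (2) If $n=2^k$ for an integer $k>2$, then $\mathrm{SL}(n,\mathbb{Q}(i))$ is minimal but not totally minimal. (3) If $n$ is not a power of $2$, then $\mathrm{SL}(n,\mathbb{Q}(i))$ is not minimal.
   Context: $\mathrm{SL}(n,\mathbb{F})$ is the group of $n\times n$ matrices over the topological field $\mathbb{F}$ of determinant $1$ with the pointwise topology inherited from $\mathbb{F}^{n^2}$. Powers of $2$ include $2^0=1$. All topological groups are Hausdorff. A topological group is minimal if it admits no strictly coarser Hausdorff group topology; $G$ is totally minimal if every Hausdorff quotient group $G/N$ ($N$ a closed normal subgroup) is minimal. *)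

theory Defs
  imports "HOL-Analysis.Analysis" "HOL-Algebra.Coset"
begin

definition topological_group :: "('a, 'b) monoid_scheme \<Rightarrow> 'a topology \<Rightarrow> bool" where
  "topological_group G T \<longleftrightarrow>
     group G \<and> topspace T = carrier G \<and>
     continuous_map (prod_topology T T) T (\<lambda>(x, y). x \<otimes>\<^bsub>G\<^esub> y) \<and>
     continuous_map T T (\<lambda>x. inv\<^bsub>G\<^esub> x)"

definition hausdorff_group :: "('a, 'b) monoid_scheme \<Rightarrow> 'a topology \<Rightarrow> bool" where
  "hausdorff_group G T \<longleftrightarrow> topological_group G T \<and> Hausdorff_space T"

definition coarser_topology :: "'a topology \<Rightarrow> 'a topology \<Rightarrow> bool" where
  "coarser_topology S T \<longleftrightarrow> topspace S = topspace T \<and> (\<forall>U. openin S U \<longrightarrow> openin T U)"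

definition minimal_group :: "('a, 'b) monoid_scheme \<Rightarrow> 'a topology \<Rightarrow> bool" where
  "minimal_group G T \<longleftrightarrow>
     hausdorff_group G T \<and>
     \<not> (\<exists>S. hausdorff_group G S \<and> coarser_topology S T \<and> S \<noteq> T)"

definition quotient_group_topology ::
    "('a, 'b) monoid_scheme \<Rightarrow> 'a topology \<Rightarrow> 'a set \<Rightarrow> 'a set topology" where
  "quotient_group_topology G T N =
     topology (\<lambda>\<U>. \<U> \<subseteq> rcosets\<^bsub>G\<^esub> N \<and> openin T {x \<in> carrier G. N #>\<^bsub>G\<^esub> x \<in> \<U>})"

definition totally_minimal_group :: "('a, 'b) monoid_scheme \<Rightarrow> 'a topology \<Rightarrow> bool" where
  "totally_minimal_group G T \<longleftrightarrow>
     hausdorff_group G T \<and>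
     (\<forall>N. N \<lhd> G \<and> closedin T N \<longrightarrow> minimal_group (G Mod N) (quotient_group_topology G T N))"

text \<open>The argument of \<^const>\<open>topology\<close> above really is a topology, and it is the
  quotient topology of the canonical projection.\<close>

lemma openin_quotient_group_topology:
  "openin (quotient_group_topology G T N) \<U> \<longleftrightarrow>
     \<U> \<subseteq> rcosets\<^bsub>G\<^esub> N \<and> openin T {x \<in> carrier G. N #>\<^bsub>G\<^esub> x \<in> \<U>}"
proof -
  have "istopology (\<lambda>\<U>. \<U> \<subseteq> rcosets\<^bsub>G\<^esub> N \<and> openin T {x \<in> carrier G. N #>\<^bsub>G\<^esub> x \<in> \<U>})"
    unfolding istopology_def
  proof (intro conjI allI impI)
    fix A B
    assume A: "A \<subseteq> rcosets\<^bsub>G\<^esub> N \<and> openin T {x \<in> carrier G. N #>\<^bsub>G\<^esub> x \<in> A}"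
      and B: "B \<subseteq> rcosets\<^bsub>G\<^esub> N \<and> openin T {x \<in> carrier G. N #>\<^bsub>G\<^esub> x \<in> B}"
    then show "A \<inter> B \<subseteq> rcosets\<^bsub>G\<^esub> N" by blast
    have "{x \<in> carrier G. N #>\<^bsub>G\<^esub> x \<in> A \<inter> B}
        = {x \<in> carrier G. N #>\<^bsub>G\<^esub> x \<in> A} \<inter> {x \<in> carrier G. N #>\<^bsub>G\<^esub> x \<in> B}" by blast
    then show "openin T {x \<in> carrier G. N #>\<^bsub>G\<^esub> x \<in> A \<inter> B}" using A B by auto
  next
    fix \<K>
    assume K: "\<forall>K\<in>\<K>. K \<subseteq> rcosets\<^bsub>G\<^esub> N \<and> openin T {x \<in> carrier G. N #>\<^bsub>G\<^esub> x \<in> K}"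
    then show "\<Union> \<K> \<subseteq> rcosets\<^bsub>G\<^esub> N" by blast
    have "{x \<in> carrier G. N #>\<^bsub>G\<^esub> x \<in> \<Union> \<K>}
        = (\<Union>K\<in>\<K>. {x \<in> carrier G. N #>\<^bsub>G\<^esub> x \<in> K})" by blast
    then show "openin T {x \<in> carrier G. N #>\<^bsub>G\<^esub> x \<in> \<Union> \<K>}" using K by auto
  qed
  then show ?thesis
    by (simp add: quotient_group_topology_def)
qed

lemma topspace_quotient_group_topology:
  assumes "topspace T = carrier G"
  shows "topspace (quotient_group_topology G T N) = carrier (G Mod N)"
proof -
  have *: "{x \<in> carrier G. N #>\<^bsub>G\<^esub> x \<in> rcosets\<^bsub>G\<^esub> N} = topspace T"
    using assms by (auto simp: RCOSETS_def)
  have "openin (quotient_group_topology G T N) (rcosets\<^bsub>G\<^esub> N)"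
    unfolding openin_quotient_group_topology * by simp
  then have "rcosets\<^bsub>G\<^esub> N \<subseteq> topspace (quotient_group_topology G T N)"
    by (rule openin_subset)
  moreover have "topspace (quotient_group_topology G T N) \<subseteq> rcosets\<^bsub>G\<^esub> N"
    using openin_topspace openin_quotient_group_topology by blast
  ultimately show ?thesis by (auto simp: FactGroup_def)
qed

lemma quotient_map_quotient_group_topology:
  assumes "topspace T = carrier G"
  shows "quotient_map T (quotient_group_topology G T N) (\<lambda>x. N #>\<^bsub>G\<^esub> x)"
  unfolding quotient_map_def
  by (auto simp: topspace_quotient_group_topology[OF assms] openin_quotient_group_topology
      assms FactGroup_def RCOSETS_def)

text \<open>The size of the matrices is the cardinality of the index type \<^typ>\<open>'n\<close>. The scalars range
  over a subset \<^term>\<open>F\<close> (intended to be a subfield) of an ambient topological ring.\<close>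

definition SL :: "'a::comm_ring_1 set \<Rightarrow> ('a^'n^'n) monoid" where
  "SL F = \<lparr>carrier = {A. (\<forall>i j. A $ i $ j \<in> F) \<and> det A = 1}, mult = (**), one = mat 1\<rparr>"

text \<open>The topology of \<^typ>\<open>'a^'n^'n\<close> is the product topology, so this is the topology
  inherited from \<^term>\<open>F\<close> entrywise.\<close>

definition SL_topology :: "'a::{comm_ring_1, topological_space} set \<Rightarrow> ('a^'n^'n) topology" where
  "SL_topology F = top_of_set (carrier (SL F))"

definition gaussian_rationals :: "complex set" where
  "gaussian_rationals = {a + b * \<i> | a b. a \<in> \<rat> \<and> b \<in> \<rat>}"

lemma gaussian_rationals_closed:
  shows "0 \<in> gaussian_rationals" "1 \<in> gaussian_rationals"
    "x \<in> gaussian_rationals \<Longrightarrow> y \<in> gaussian_rationals \<Longrightarrow> x + y \<in> gaussian_rationals"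
    "x \<in> gaussian_rationals \<Longrightarrow> - x \<in> gaussian_rationals"
    "x \<in> gaussian_rationals \<Longrightarrow> y \<in> gaussian_rationals \<Longrightarrow> x * y \<in> gaussian_rationals"
proof -
  have I: "a + b * \<i> \<in> gaussian_rationals" if "a \<in> \<rat>" "b \<in> \<rat>" for a b
    using that by (auto simp: gaussian_rationals_def)
  show "0 \<in> gaussian_rationals" "1 \<in> gaussian_rationals"
    using I[of 0 0] I[of 1 0] by auto
  { fix x y assume "x \<in> gaussian_rationals" "y \<in> gaussian_rationals"
    then obtain a b c d where *: "a \<in> \<rat>" "b \<in> \<rat>" "c \<in> \<rat>" "d \<in> \<rat>"
      "x = a + b * \<i>" "y = c + d * \<i>" by (auto simp: gaussian_rationals_def)
    have "x + y = (a + c) + (b + d) * \<i>" "- x = (- a) + (- b) * \<i>"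
      "x * y = (a * c - b * d) + (a * d + b * c) * \<i>"
      using * by (auto simp: algebra_simps)
    then have "x + y \<in> gaussian_rationals" "- x \<in> gaussian_rationals" "x * y \<in> gaussian_rationals"
      using I * by (metis Rats_add, metis Rats_minus_iff,
          metis Rats_add Rats_diff Rats_mult) }
  note R = this
  show "x \<in> gaussian_rationals \<Longrightarrow> y \<in> gaussian_rationals \<Longrightarrow> x + y \<in> gaussian_rationals"
    "x \<in> gaussian_rationals \<Longrightarrow> - x \<in> gaussian_rationals"
    "x \<in> gaussian_rationals \<Longrightarrow> y \<in> gaussian_rationals \<Longrightarrow> x * y \<in> gaussian_rationals"
    using R by blast+
qed

lemma det_closed:
  fixes A :: "'a::comm_ring_1^'n^'n"
  assumes F: "0 \<in> F" "1 \<in> F" "\<And>x y. x \<in> F \<Longrightarrow> y \<in> F \<Longrightarrow> x + y \<in> F"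
    "\<And>x. x \<in> F \<Longrightarrow> - x \<in> F" "\<And>x y. x \<in> F \<Longrightarrow> y \<in> F \<Longrightarrow> x * y \<in> F"
    and A: "\<And>i j. A $ i $ j \<in> F"
  shows "det A \<in> F"
proof -
  have s: "sum f S \<in> F" if "\<And>x. x \<in> S \<Longrightarrow> f x \<in> F" for f :: "('n \<Rightarrow> 'n) \<Rightarrow> 'a" and S
    using that by (induction S rule: infinite_finite_induct) (auto simp: F)
  have p: "prod f S \<in> F" if "\<And>x. x \<in> S \<Longrightarrow> f x \<in> F" for f :: "'n \<Rightarrow> 'a" and S
    using that by (induction S rule: infinite_finite_induct) (auto simp: F)
  show ?thesis
    unfolding det_def by (rule s) (auto simp: sign_def intro!: F p A)
qed

text \<open>The entries of the inverse, by Cramer's rule.\<close>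

definition cramer_inverse :: "'a::field^'n^'n \<Rightarrow> 'a^'n^'n" where
  "cramer_inverse A = (\<chi> k l. det (\<chi> i j. if j = k then axis l 1 $ i else A $ i $ j))"

lemma mult_cramer_inverse:
  fixes A :: "'a::field^'n^'n"
  assumes "det A = 1"
  shows "A ** cramer_inverse A = mat 1" "cramer_inverse A ** A = mat 1" "det (cramer_inverse A) = 1"
proof -
  have "A *v column l (cramer_inverse A) = axis l 1" for l
    using assms
    by (subst cramer) (auto simp: column_def cramer_inverse_def vec_eq_iff)
  moreover have "column l (A ** cramer_inverse A) = A *v column l (cramer_inverse A)" for l
    by (simp add: column_def matrix_matrix_mult_def matrix_vector_mult_def vec_eq_iff)
  ultimately show 1: "A ** cramer_inverse A = mat 1"
    by (auto simp: vec_eq_iff column_def axis_def mat_def)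
  then show "cramer_inverse A ** A = mat 1"
    by (simp add: matrix_left_right_inverse)
  have "det A * det (cramer_inverse A) = 1"
    using arg_cong[OF 1, of det] by (simp add: det_mul)
  then show "det (cramer_inverse A) = 1" using assms by simp
qed

lemma SL_group:
  fixes F :: "'a::field set"
  assumes F: "0 \<in> F" "1 \<in> F" "\<And>x y. x \<in> F \<Longrightarrow> y \<in> F \<Longrightarrow> x + y \<in> F"
    "\<And>x. x \<in> F \<Longrightarrow> - x \<in> F" "\<And>x y. x \<in> F \<Longrightarrow> y \<in> F \<Longrightarrow> x * y \<in> F"
  shows "group (SL F :: ('a^'n^'n) monoid)"
    and "\<And>A :: 'a^'n^'n. A \<in> carrier (SL F) \<Longrightarrow> inv\<^bsub>SL F\<^esub> A = cramer_inverse A"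
proof -
  have s: "sum f S \<in> F" if "\<And>x. x \<in> S \<Longrightarrow> f x \<in> F" for f :: "'n \<Rightarrow> 'a" and S
    using that by (induction S rule: infinite_finite_induct) (auto simp: F)
  have ci: "cramer_inverse A \<in> carrier (SL F)" if "A \<in> carrier (SL F)" for A :: "'a^'n^'n"
    using that by (auto simp: SL_def mult_cramer_inverse)
      (auto simp: cramer_inverse_def axis_def intro!: det_closed F)
  show g: "group (SL F :: ('a^'n^'n) monoid)"
  proof (rule groupI)
    fix x :: "'a^'n^'n" assume x: "x \<in> carrier (SL F)"
    show "\<exists>y\<in>carrier (SL F). y \<otimes>\<^bsub>SL F\<^esub> x = \<one>\<^bsub>SL F\<^esub>"
      using x by (intro bexI[OF _ ci[OF x]]) (simp add: SL_def mult_cramer_inverse)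
  next
    show "\<one>\<^bsub>SL F\<^esub> \<in> carrier (SL F :: ('a^'n^'n) monoid)"
      using det_I[where 'a='a and 'n='n] by (auto simp: SL_def) (auto simp: mat_def F)
  next
    fix x y :: "'a^'n^'n"
    assume "x \<in> carrier (SL F)" "y \<in> carrier (SL F)"
    moreover from this have "(x ** y) $ i $ j \<in> F" for i j
      by (simp add: SL_def matrix_matrix_mult_def s F)
    ultimately show "x \<otimes>\<^bsub>SL F\<^esub> y \<in> carrier (SL F)"
      by (simp add: SL_def det_mul)
  qed (auto simp: SL_def matrix_mul_assoc)
  fix A :: "'a^'n^'n" assume A: "A \<in> carrier (SL F)"
  show "inv\<^bsub>SL F\<^esub> A = cramer_inverse A"
    by (rule group.inv_equality[OF g _ A ci[OF A]])
      (use A in \<open>auto simp: SL_def mult_cramer_inverse\<close>)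
qed

lemma continuous_on_det [continuous_intros]:
  fixes f :: "'b::topological_space \<Rightarrow> complex^'n^'n"
  assumes "continuous_on S f"
  shows "continuous_on S (\<lambda>x. det (f x))"
  unfolding det_def by (intro continuous_intros assms)

lemma hausdorff_group_SL:
  "hausdorff_group (SL gaussian_rationals :: (complex^'n^'n) monoid) (SL_topology gaussian_rationals)"
proof -
  let ?G = "SL gaussian_rationals :: (complex^'n^'n) monoid"
  note g = SL_group[OF gaussian_rationals_closed]
  interpret group ?G by (rule g(1))
  have m: "mult ?G = (**)" by (simp add: SL_def)
  have "continuous_on (carrier ?G \<times> carrier ?G) (\<lambda>p. fst p ** snd p)"
    unfolding matrix_matrix_mult_def by (intro continuous_intros)
  moreover have "fst p ** snd p \<in> carrier ?G" if "p \<in> carrier ?G \<times> carrier ?G" for p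
    using that m_closed[of "fst p" "snd p"] by (auto simp: m)
  ultimately have 1: "continuous_map (prod_topology (top_of_set (carrier ?G)) (top_of_set (carrier ?G)))
      (top_of_set (carrier ?G)) (\<lambda>(x, y). x \<otimes>\<^bsub>?G\<^esub> y)"
    by (auto simp: m case_prod_unfold)
  have "continuous_on (carrier ?G) (cramer_inverse :: complex^'n^'n \<Rightarrow> complex^'n^'n)"
    unfolding cramer_inverse_def
    apply (intro continuous_intros)
    subgoal for k l i j by (cases "j = k") (auto intro!: continuous_intros)
    done
  then have "continuous_on (carrier ?G) (\<lambda>x. inv\<^bsub>?G\<^esub> x)"
    by (rule continuous_on_eq) (simp add: g(2))
  then have 2: "continuous_map (top_of_set (carrier ?G)) (top_of_set (carrier ?G)) (\<lambda>x. inv\<^bsub>?G\<^esub> x)"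
    by auto
  show ?thesis
    using 1 2 g(1)
    by (auto simp: hausdorff_group_def topological_group_def SL_topology_def
        intro: Hausdorff_space_subtopology)
qed

end

theory Submission
  imports Defs
begin

text \<open>
  Write \<open>H = SL(n, \<rat>(\<i>))\<close>, a dense subgroup of \<open>G = SL(n, \<complex>)\<close>, and let \<open>N\<close> be the kernel of a
  quotient map of \<open>H\<close> onto \<open>Q\<close>. For a coarser Hausdorff group topology on \<open>Q\<close>, let \<open>M\<close> be the
  intersection of the closures in \<open>G\<close> of the preimages of the neighbourhoods of \<open>1\<close>: a closed
  submonoid of \<open>G\<close>, normalised by \<open>H\<close>, with \<open>M \<inter> H = N\<close>. If all these preimages are unbounded,
  conjugating small transvections by their elements yields in the limit a one-parameter group
  \<open>1 + s X\<close> in \<open>M\<close> with \<open>X \<noteq> 0\<close> and \<open>X\<^sup>2 = 0\<close>; hence \<open>M\<close> contains all transvections, \<open>N = H\<close>, and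
  \<open>Q\<close> is trivial. If one of them is bounded, then \<open>M\<close> consists of scalar \<open>n\<close>-th roots of unity, and
  compactness shows that the topology is not strictly coarser as soon as \<open>M = N\<close>.

  So everything depends on roots of unity, and those in \<open>\<rat>(\<i>)\<close> satisfy \<open>x\<^sup>4 = 1\<close>. If \<open>n\<close> divides \<open>4\<close>,
  then \<open>M \<subseteq> H\<close>; if \<open>n\<close> is a power of \<open>2\<close>, a nontrivial \<open>M\<close> contains \<open>-1\<close>. Conversely, an \<open>n\<close>-th root of
  unity \<open>z\<close> with \<open>z\<^sup>4 \<noteq> 1\<close> (of order \<open>8\<close>, or of odd order) makes the topology that \<open>H / (H \<inter> \<langle>z\<rangle>)\<close>
  inherits from \<open>G / \<langle>z\<rangle>\<close> strictly coarser.
\<close>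

section \<open>Transvections\<close>

definition transvection :: "'n \<Rightarrow> 'n \<Rightarrow> 'a \<Rightarrow> 'a::comm_ring_1^'n^'n" where
  "transvection i j c = (\<chi> a b. (if a = b then 1 else 0) + (if a = i \<and> b = j then c else 0))"

lemma transvection_mult:
  "transvection i j c ** A = (\<chi> a b. A $ a $ b + (if a = i then c * A $ j $ b else 0))"
proof -
  have "(\<Sum>k\<in>UNIV. ((if a = k then 1 else 0) + (if a = i \<and> k = j then c else 0)) * A $ k $ b)
      = A $ a $ b + (if a = i then c * A $ j $ b else 0)" for a b
    by (cases "a = i") (simp_all add: distrib_right sum.distrib if_distrib [of "\<lambda>x. x * _"] cong: if_cong)
  then show ?thesis
    by (simp add: transvection_def matrix_matrix_mult_def)
qed

lemma mult_transvection:
  "A ** transvection i j c = (\<chi> a b. A $ a $ b + (if b = j then A $ a $ i * c else 0))"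
proof -
  have "(\<Sum>k\<in>UNIV. A $ a $ k * ((if k = b then 1 else 0) + (if k = i \<and> b = j then c else 0)))
      = A $ a $ b + (if b = j then A $ a $ i * c else 0)" for a b
    by (cases "b = j") (simp_all add: distrib_left sum.distrib if_distrib [of "\<lambda>x. _ * x"] cong: if_cong)
  then show ?thesis
    by (simp add: transvection_def matrix_matrix_mult_def)
qed

lemma transvection_0 [simp]: "transvection i j 0 = mat 1"
  by (simp add: transvection_def mat_def vec_eq_iff)

lemma transvection_add:
  "i \<noteq> j \<Longrightarrow> transvection i j c ** transvection i j d = transvection i j (c + d)"
  by (auto simp: transvection_mult) (auto simp: transvection_def vec_eq_iff)

lemma det_transvection:
  fixes c :: "'a::comm_ring_1"
  assumes "i \<noteq> j"

  shows "det (transvection i j c :: 'a^'n^'n) = 1"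
proof -
  have "(transvection i j c :: 'a^'n^'n) = (\<chi> k. if k = i then row i (mat 1) + c *s row j (mat 1) else row k (mat 1))"
    by (auto simp: transvection_def row_def mat_def vec_eq_iff)
  then show ?thesis
    using det_row_operation[OF assms, of "mat 1 :: 'a^'n^'n" c] by simp
qed

text \<open>The entries are polynomials of degree at most 2 in \<open>c\<close>. Below,
  \<open>c\<close> runs through the natural numbers: the linear terms show that bounded families
  invariant under such conjugations are scalar, and the quadratic term singles out
  \<open>A $ j $ i\<close> in the limit.\<close>

lemma conj_transvection_nth:
  "(transvection i j c ** A ** transvection i j (- c)) $ a $ b
     = A $ a $ b + (if a = i then c * A $ j $ b else 0) - (if b = j then c * A $ a $ i else 0)
       - (if a = i \<and> b = j then c * c * A $ j $ i else 0)"
  by (simp add: transvection_mult mult_transvection algebra_simps)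

lemma mat_mult_nth [simp]:
  "(mat c ** A) $ a $ b = c * A $ a $ b" "(A ** mat c) $ a $ b = A $ a $ b * c"
  by (simp_all add: matrix_matrix_mult_def mat_def if_distrib [of "\<lambda>x. x * _"]
      if_distrib [of "\<lambda>x. _ * x"] cong: if_cong)

text \<open>One row operation per element of \<open>F\<close>. Row \<open>k\<close> is never touched
  because \<open>k\<close> lies outside \<open>F\<close>, so each operation still uses the original
  row \<open>k\<close>. If \<open>A $ k $ k = 1\<close>, this clears column \<open>k\<close> in the
  rows of \<open>F\<close>. The set \<open>S\<close> is only a monoid containing the transvections,
  so that the result applies to submonoids.\<close>

lemma clear_column:
  fixes A :: "'a::comm_ring_1^'n^'n"
  assumes one: "mat 1 \<in> S" and mult: "\<And>A B. A \<in> S \<Longrightarrow> B \<in> S \<Longrightarrow> A ** B \<in> S"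
    and trans: "\<And>i j c. i \<noteq> j \<Longrightarrow> transvection i j c \<in> S"
    and F: "k \<notin> F"
  shows "\<exists>U\<in>S. U ** A = (\<chi> a b. if a \<in> F then A $ a $ b - A $ a $ k * A $ k $ b else A $ a $ b)"
  using finite[of F] F
proof (induction F rule: finite_induct)
  case empty
  show ?case using one by (intro bexI[of _ "mat 1"]) (auto simp: vec_eq_iff)
next
  case (insert x F)
  then obtain U where U: "U \<in> S"
    "U ** A = (\<chi> a b. if a \<in> F then A $ a $ b - A $ a $ k * A $ k $ b else A $ a $ b)" by auto
  have "transvection x k (- A $ x $ k) ** U \<in> S"
    using insert.prems by (intro mult trans U) auto
  moreover have "(transvection x k (- A $ x $ k) ** U) ** A
      = (\<chi> a b. if a \<in> insert x F then A $ a $ b - A $ a $ k * A $ k $ b else A $ a $ b)"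
    unfolding matrix_mul_assoc[symmetric] U(2)
    using insert.prems insert.hyps by (auto simp: vec_eq_iff transvection_mult)
  ultimately show ?case by blast
qed

text \<open>Gaussian elimination by row operations of determinant \<open>1\<close>; the last column needs no
  scaling because the determinant is \<open>1\<close>.\<close>

lemma reduce_columns:
  fixes A :: "'a::field^'n^'n"
  assumes one: "mat 1 \<in> S" and mult: "\<And>A B. A \<in> S \<Longrightarrow> B \<in> S \<Longrightarrow> A ** B \<in> S"
    and trans: "\<And>i j c. i \<noteq> j \<Longrightarrow> transvection i j c \<in> S"
    and S: "\<And>A. A \<in> S \<Longrightarrow> det A = 1"
    and A: "det A = 1" and K: "l \<notin> K"
  shows "\<exists>U\<in>S. \<forall>k\<in>K. \<forall>a. (U ** A) $ a $ k = (if a = k then 1 else 0)"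
  using finite[of K] K
proof (induction K rule: finite_induct)
  case empty
  show ?case using one by auto
next
  case (insert k K)
  define good :: "'a^'n^'n \<Rightarrow> bool" where
    "good B \<longleftrightarrow> (\<forall>j\<in>K. \<forall>a. B $ a $ j = (if a = j then 1 else 0))" for B
  from insert obtain U where U: "U \<in> S" and UK: "good (U ** A)"
    by (auto simp: good_def)
  define B where "B = U ** A"
  have detB: "det B = 1"
    using S[OF U] A by (simp add: B_def det_mul)
  have lk: "l \<noteq> k" "l \<notin> K" using insert.prems by auto
  have "\<exists>i. i \<notin> K \<and> B $ i $ k \<noteq> 0"
  proof (rule ccontr)
    assume "\<not> ?thesis"
    then have 0: "B $ a $ k = 0" if "a \<notin> K" for a using that by auto
    \<comment> \<open>This is \<open>e_k\<close> minus the combination of the \<open>e_j\<close>,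
      \<open>j\<close> in \<open>K\<close>, with coefficients \<open>B $ j $ k\<close>. The columns
      of \<open>B\<close> in \<open>K\<close> are already unit vectors, so \<open>B\<close> maps
      this vector to column \<open>k\<close> with the rows in \<open>K\<close> erased, which is 0 by
      assumption. That contradicts the invertibility of \<open>B\<close>.\<close>
    define x :: "'a^'n" where "x = (\<chi> j. (if j = k then 1 else 0) - (if j \<in> K then B $ j $ k else 0))"
    have "(B *v x) $ a = 0" for a
    proof -
      have "(B *v x) $ a = (\<Sum>j\<in>UNIV. (if j = k then B $ a $ j else 0) - (if j \<in> K then B $ a $ j * B $ j $ k else 0))"
        unfolding matrix_vector_mult_def x_def
        by (simp add: right_diff_distrib if_distrib [of "\<lambda>x. _ * x"] cong: if_cong)
      also have "\<dots> = B $ a $ k - (\<Sum>j\<in>K. B $ a $ j * B $ j $ k)"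
        by (simp add: sum_subtractf sum.If_cases)
      also have "(\<Sum>j\<in>K. B $ a $ j * B $ j $ k) = (\<Sum>j\<in>K. if a = j then B $ j $ k else 0)"
        using UK by (intro sum.cong) (auto simp: good_def B_def)
      also have "B $ a $ k - \<dots> = 0"
        using 0 insert.hyps by (auto simp: sum.delta)
      finally show ?thesis .
    qed
    then have "B *v x = 0" by (simp add: vec_eq_iff)
    then have "x = 0"
      using mult_cramer_inverse(2)[OF detB]
      by (metis matrix_vector_mul_assoc matrix_vector_mul_lid matrix_vector_mult_0_right)
    moreover have "x $ k = 1" using insert.hyps by (simp add: x_def)
    ultimately show False by simp
  qed
  then obtain i where i: "i \<notin> K" "B $ i $ k \<noteq> 0" by auto
  have step: "\<exists>V\<in>S. good (V ** B) \<and> (V ** B) $ k $ k = 1"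
    if "i \<notin> K" "i \<noteq> k" "B $ i $ k \<noteq> 0" "good B" for i B
  proof (intro bexI conjI)
    \<comment> \<open>Adding a multiple of row \<open>i\<close> to row \<open>k\<close> makes the
      pivot 1 without any scaling. Row \<open>i\<close> vanishes in the columns of \<open>K\<close>,
      so those columns are preserved.\<close>
    let ?T = "transvection k i ((1 - B $ k $ k) / B $ i $ k)"
    show "?T \<in> S" using that by (intro trans) auto
    show "good (?T ** B)"
      using that by (auto simp: good_def transvection_mult)
    show "(?T ** B) $ k $ k = 1" using that by (simp add: transvection_mult)
  qed
  have "\<exists>V\<in>S. good (V ** B) \<and> (V ** B) $ k $ k = 1"
  proof (cases "\<exists>i. i \<notin> K \<and> i \<noteq> k \<and> B $ i $ k \<noteq> 0")
    case True
    then show ?thesis using step UK by (auto simp: B_def)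
  next
    case False
    then have k: "B $ k $ k \<noteq> 0" "B $ l $ k = 0" using i lk by auto
    \<comment> \<open>Here the only nonzero entry of column \<open>k\<close> outside
      \<open>K\<close> is the diagonal one. Adding row \<open>k\<close> to the reserved row
      \<open>l\<close> creates another one, and \<open>step\<close> applies with \<open>l\<close> as
      source row.\<close>
    let ?B = "transvection l k 1 ** B"
    have "good ?B" "?B $ l $ k \<noteq> 0"
      using UK insert.hyps k by (auto simp: good_def transvection_mult B_def[symmetric])
    from step[OF lk(2) lk(1) this(2,1)] obtain V where
      "V \<in> S" "good (V ** ?B)" "(V ** ?B) $ k $ k = 1" by auto
    then show ?thesis
      by (intro bexI[of _ "V ** transvection l k 1"] mult trans)
        (auto simp: matrix_mul_assoc lk)
  qed
  then obtain V where V: "V \<in> S" "good (V ** B)" "(V ** B) $ k $ k = 1" by auto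
  obtain W where W: "W \<in> S" "W ** (V ** B) = (\<chi> a b. if a \<in> - {k} then (V ** B) $ a $ b
      - (V ** B) $ a $ k * (V ** B) $ k $ b else (V ** B) $ a $ b)"
    using clear_column[OF one mult trans, of k "- {k}" "V ** B"] by auto
  have "W ** V ** U \<in> S" using U V W mult by auto
  moreover have "(W ** V ** U) ** A = W ** (V ** B)" by (simp add: B_def matrix_mul_assoc)
  moreover have "(W ** (V ** B)) $ a $ j = (if a = j then 1 else 0)" if "j \<in> insert k K" for a j
    unfolding W(2) using that V(2,3) insert.hyps by (auto simp: good_def)
  ultimately show ?case by metis
qed

text \<open>Elimination turns \<open>A\<close> into the identity by left multiplication, so
  \<open>A\<close> is the inverse of an element of \<open>S\<close>. As \<open>S\<close> need not be
  closed under inverses, the argument runs in the group \<open>S'\<close> of those elements of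
  determinant 1 in \<open>S\<close> whose inverses also lie in \<open>S\<close>.\<close>

lemma transvections_generate_SL:
  fixes A :: "'a::field^'n^'n"
  assumes one: "mat 1 \<in> S" and mult: "\<And>A B. A \<in> S \<Longrightarrow> B \<in> S \<Longrightarrow> A ** B \<in> S"
    and trans: "\<And>i j c. i \<noteq> j \<Longrightarrow> transvection i j c \<in> S"
    and A: "det A = 1"
  shows "A \<in> S"
proof -
  define S' where "S' = {B \<in> S. det B = 1 \<and> cramer_inverse B \<in> S}"
  have inv: "cramer_inverse B = C" if "B ** C = mat 1" "det B = 1" for B C :: "'a^'n^'n"
    by (metis that matrix_mul_assoc matrix_mul_lid matrix_mul_rid mult_cramer_inverse(2))
  have one': "mat 1 \<in> S'"
    using one inv[of "mat 1" "mat 1"] by (simp add: S'_def)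
  have mult': "B ** C \<in> S'" if "B \<in> S'" "C \<in> S'" for B C
  proof -
    have "(B ** C) ** (cramer_inverse C ** cramer_inverse B) = B ** (C ** cramer_inverse C) ** cramer_inverse B"
      by (simp add: matrix_mul_assoc)
    also have "\<dots> = mat 1" using that by (simp add: S'_def mult_cramer_inverse)
    finally have "cramer_inverse (B ** C) = cramer_inverse C ** cramer_inverse B"
      using that by (intro inv) (auto simp: S'_def det_mul)
    then show ?thesis using that by (auto simp: S'_def det_mul mult)
  qed
  have trans': "transvection i j c \<in> S'" if "i \<noteq> j" for i j and c :: 'a
    using that inv[of "transvection i j c" "transvection i j (- c)"]
    by (simp add: S'_def trans transvection_add det_transvection)
  obtain k :: 'n where True by simp
  have "\<exists>U\<in>S'. \<forall>j\<in>- {k}. \<forall>a. (U ** A) $ a $ j = (if a = j then 1 else 0)"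
    using A by (intro reduce_columns[of S' A k, OF one' mult' trans']) (auto simp: S'_def)
  then obtain U where U: "U \<in> S'" "\<And>a j. j \<noteq> k \<Longrightarrow> (U ** A) $ a $ j = (if a = j then 1 else 0)"
    by auto
  define B where "B = U ** A"
  \<comment> \<open>The matrix \<open>B\<close> differs from the identity in column \<open>k\<close>
    only. In this form Cramer's lemma evaluates its determinant as \<open>B $ k $ k\<close>, which
    is why the last pivot is already 1.\<close>
  have B: "B = (\<chi> i j. if j = k then (mat 1 *v column k B) $ i else mat 1 $ i $ j)"
    using U(2) unfolding matrix_vector_mul_lid by (auto simp: B_def[symmetric] vec_eq_iff mat_def column_def)
  have "det B = 1" using U A by (simp add: S'_def B_def det_mul)
  moreover have "det B = B $ k $ k"
    by (subst B, subst cramer_lemma) (simp add: column_def)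
  ultimately have kk: "B $ k $ k = 1" by simp
  obtain V where V: "V \<in> S'" "V ** B = (\<chi> a b. if a \<in> - {k} then B $ a $ b - B $ a $ k * B $ k $ b else B $ a $ b)"
    using clear_column[OF one' mult' trans', of k "- {k}" B] by auto
  have "V ** B = mat 1"
    unfolding V(2) using kk U(2) by (auto simp: vec_eq_iff mat_def B_def[symmetric])
  then have "(V ** U) ** A = mat 1" by (simp add: B_def matrix_mul_assoc)
  then have "A = cramer_inverse (V ** U)"
    using mult'[OF V(1) U(1)] inv[of "V ** U" A] by (simp add: S'_def)
  then show ?thesis using mult'[OF V(1) U(1)] by (simp add: S'_def)
qed

section \<open>Roots of unity in the Gaussian rationals\<close>

lemma complex_of_real_of_rat: "complex_of_real (of_rat q) = of_rat q"
  by (cases q) (simp add: of_rat_rat)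

lemma gaussian_rationals_iff: "x \<in> gaussian_rationals \<longleftrightarrow> Re x \<in> \<rat> \<and> Im x \<in> \<rat>"
proof
  assume "x \<in> gaussian_rationals"
  then obtain a b where "a \<in> \<rat>" "b \<in> \<rat>" and x: "x = a + b * \<i>"
    by (auto simp: gaussian_rationals_def)
  then obtain p q where "a = of_rat p" "b = of_rat q" by (auto elim!: Rats_cases)
  then have "x = complex_of_real (of_rat p) + complex_of_real (of_rat q) * \<i>"
    by (simp add: x complex_of_real_of_rat)
  then show "Re x \<in> \<rat> \<and> Im x \<in> \<rat>" by simp
next
  assume "Re x \<in> \<rat> \<and> Im x \<in> \<rat>"
  then obtain p q where "Re x = of_rat p" "Im x = of_rat q" by (auto elim!: Rats_cases)
  then have "x = of_rat p + of_rat q * \<i>"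
    by (simp add: complex_eq_iff flip: complex_of_real_of_rat)
  then show "x \<in> gaussian_rationals"
    unfolding gaussian_rationals_def by (intro CollectI exI[of _ "of_rat p"] exI[of _ "of_rat q"]) simp
qed

lemma gaussian_rationals_power: "x \<in> gaussian_rationals \<Longrightarrow> x ^ k \<in> gaussian_rationals"
  by (induction k) (auto intro: gaussian_rationals_closed)

lemma gaussian_rationals_inverse: "x \<in> gaussian_rationals \<Longrightarrow> inverse x \<in> gaussian_rationals"
  by (auto simp: gaussian_rationals_iff)

lemma closure_gaussian_rationals: "closure gaussian_rationals = UNIV"
proof -
  have "\<exists>w\<in>gaussian_rationals. dist w z < e" if "e > 0" for z e
  proof -
    have "Re z < Re z + e / 2" "Im z < Im z + e / 2" using that by auto
    then obtain r s where "r \<in> \<rat>" "Re z < r" "r < Re z + e / 2" "s \<in> \<rat>" "Im z < s" "s < Im z + e / 2"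
      by (metis Rats_dense_in_real)
    moreover from this have "dist (Complex r s) z < e"
      unfolding dist_norm using cmod_le[of "Complex r s - z"] by simp
    ultimately show ?thesis by (intro bexI[of _ "Complex r s"]) (auto simp: gaussian_rationals_iff)
  qed
  then show ?thesis by (auto simp: closure_approachable)
qed

lemma gaussian_rationals_minus_ii: "- \<i> \<in> gaussian_rationals"
  by (simp add: gaussian_rationals_iff)

section \<open>Integrality of twice the real part of a root of unity in \<rat>(\<i>)\<close>

lemma Rats_common_denominator:
  fixes R :: "real set"
  assumes "finite R" "R \<subseteq> \<rat>"
  obtains D :: nat where "D > 0" "\<And>u. u \<in> R \<Longrightarrow> real D * u \<in> \<int>"
proof -
  have "\<exists>D::nat. D > 0 \<and> (\<forall>u\<in>R. real D * u \<in> \<int>)"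
    using assms
  proof (induction R rule: finite_induct)
    case (insert x R)
    then obtain D :: nat where D: "D > 0" "\<And>u. u \<in> R \<Longrightarrow> real D * u \<in> \<int>" by auto
    obtain m :: int and n :: nat where "n > 0" "x = of_int m / of_nat n"
      using insert.prems by (auto simp: Rats_eq_int_div_nat)
    then have "real (D * n) * x \<in> \<int>" by simp
    moreover have "real (D * n) * u \<in> \<int>" if "u \<in> R" for u
      using Ints_mult[OF Ints_of_nat[of n] D(2)[OF that]] by (simp add: mult_ac)
    ultimately show ?case using D(1) \<open>n > 0\<close> by (intro exI[of _ "D * n"]) auto
  qed auto
  then show ?thesis using that by blast
qed

text \<open>If \<open>u\<close> has denominator \<open>s\<close>, then the \<open>k\<close>-th iterate of \<open>u \<mapsto> u\<^sup>2 - 2\<close> at \<open>u\<close>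
  has denominator \<open>s ^ 2 ^ k\<close>.\<close>

lemma finite_invariant_Rats_subset_Ints:
  fixes R :: "real set"
  assumes R: "finite R" "R \<subseteq> \<rat>" and inv: "\<And>u. u \<in> R \<Longrightarrow> u\<^sup>2 - 2 \<in> R"
  shows "R \<subseteq> \<int>"
proof
  fix u assume u: "u \<in> R"
  obtain D :: nat where D: "D > 0" "\<And>u. u \<in> R \<Longrightarrow> real D * u \<in> \<int>"
    by (rule Rats_common_denominator[OF R]) blast
  obtain q where q: "u = of_rat q" using u R(2) by (auto elim: Rats_cases)
  obtain p s where ps: "quotient_of q = (p, s)" by force
  then have s: "s > 0" "coprime p s" and ups: "u = of_int p / of_int s"
    by (auto simp: quotient_of_denom_pos quotient_of_coprime q quotient_of_div[OF ps] of_rat_divide)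
  have iter: "\<exists>v\<in>R. \<exists>p. coprime p s \<and> v = of_int p / of_int (s ^ 2 ^ k)" for k
  proof (induction k)
    case 0
    show ?case using u s ups by auto
  next
    case (Suc k)
    then obtain v p where v: "v \<in> R" "coprime p s" "v = of_int p / of_int (s ^ 2 ^ k)" by auto
    have "v\<^sup>2 - 2 = of_int (p\<^sup>2 - 2 * (s ^ 2 ^ k)\<^sup>2) / of_int (s ^ 2 ^ Suc k)"
      using s(1) unfolding v(3) by (simp add: power_divide diff_divide_distrib power_mult mult.commute[of 2])
    moreover have "s dvd 2 * (s ^ 2 ^ k)\<^sup>2" by (simp add: dvd_power dvd_mult power2_eq_square)
    then obtain w where w: "2 * (s ^ 2 ^ k)\<^sup>2 = s * w" by (elim dvdE)
    have "coprime (p\<^sup>2 - s * w) s"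
    proof -
      have "coprime (p\<^sup>2) s" using v by simp
      moreover have "gcd (p\<^sup>2 - s * w) s = gcd (p\<^sup>2) s"
        by (metis gcd.commute gcd_add_mult diff_add_cancel add.commute mult.commute)
      ultimately show ?thesis by (simp add: coprime_iff_gcd_eq_1)
    qed
    then have "coprime (p\<^sup>2 - 2 * (s ^ 2 ^ k)\<^sup>2) s" by (simp only: w)
    ultimately show ?case using inv[OF v(1)] by blast
  qed
  have "s = 1"
  proof (rule ccontr)
    assume "s \<noteq> 1"
    then have s2: "s \<ge> 2" using s by auto
    \<comment> \<open>The number of iterations is \<open>D\<close> itself: since \<open>D\<close>
      clears the denominator of \<open>v\<close>, the number \<open>s ^ 2 ^ D\<close> would divide
      \<open>D\<close>, although it is at least \<open>2 ^ D\<close> and hence larger than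
      \<open>D\<close>.\<close>
    obtain v p where v: "v \<in> R" "coprime p s" "v = of_int p / of_int (s ^ 2 ^ D)" using iter by blast
    obtain z where "real D * v = of_int z" using D(2)[OF v(1)] by (auto elim: Ints_cases)
    then have "real_of_int (int D * p) = of_int (z * s ^ 2 ^ D)"
      using s v(3) by (simp add: field_simps)
    then have "int D * p = z * s ^ 2 ^ D" by (simp only: of_int_eq_iff)
    then have "s ^ 2 ^ D dvd int D * p" by simp
    moreover have "coprime (s ^ 2 ^ D) p" using v(2) by (simp add: coprime_commute)
    ultimately have "s ^ 2 ^ D dvd int D" by (simp add: coprime_dvd_mult_left_iff)
    then have "s ^ 2 ^ D \<le> int D" using D(1) by (intro zdvd_imp_le) auto
    moreover have "int D < 2 ^ D" by (simp add: of_nat_less_two_power)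
    moreover have "(2::int) ^ D \<le> 2 ^ 2 ^ D"
      by (intro power_increasing) (auto intro: less_imp_le)
    moreover have "(2::int) ^ 2 ^ D \<le> s ^ 2 ^ D" using s2 by (intro power_mono) auto
    ultimately show False by linarith
  qed
  then show "u \<in> \<int>" using ups by simp
qed

text \<open>For \<open>norm x = 1\<close> the number \<open>2 * Re x\<close> is
  \<open>x + 1 / x\<close>, and squaring \<open>x\<close> acts on it by
  \<open>u \<mapsto> u\<^sup>2 - 2\<close>. The values belonging to all powers of \<open>x\<close>
  form a finite set of rationals stable under this map.\<close>

lemma double_Re_root_of_unity:
  assumes "x \<in> gaussian_rationals" "x ^ m = 1" "m > 0"
  shows "2 * Re x \<in> \<int>"
proof -
  let ?R = "(\<lambda>j. 2 * Re (x ^ j)) ` UNIV"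
  have n: "norm x = 1" using assms by (metis power_eq_1_iff less_not_refl2 norm_one norm_power norm_ge_zero)
  have per: "x ^ j = x ^ (j mod m)" for j
    by (metis assms(2) div_mult_mod_eq mult.commute mult_1 power_add power_mult power_one)
  have "?R \<subseteq> (\<lambda>j. 2 * Re (x ^ j)) ` {..<m}"
  proof (rule image_subsetI)
    fix j
    have "2 * Re (x ^ j) = 2 * Re (x ^ (j mod m))" using per[of j] by simp
    then show "2 * Re (x ^ j) \<in> (\<lambda>j. 2 * Re (x ^ j)) ` {..<m}"
      using assms(3) by (intro image_eqI[of _ _ "j mod m"]) auto
  qed
  then have "finite ?R" by (rule finite_surj[OF finite_lessThan])
  moreover have "?R \<subseteq> \<rat>"
    using gaussian_rationals_power[OF assms(1)] by (auto simp: gaussian_rationals_iff)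
  moreover have "u\<^sup>2 - 2 \<in> ?R" if u: "u \<in> ?R" for u
  proof -
    obtain j where j: "u = 2 * Re (x ^ j)" using u by blast
    have "norm (x ^ j) = 1" by (simp add: norm_power n)
    then have "(Re (x ^ j))\<^sup>2 + (Im (x ^ j))\<^sup>2 = 1"
      by (simp add: cmod_power2 [symmetric])
    then have "u\<^sup>2 - 2 = 2 * Re (x ^ (j + j))"
      unfolding power_add by (simp add: j power2_eq_square)
    then show ?thesis by blast
  qed
  ultimately have "?R \<subseteq> \<int>" by (rule finite_invariant_Rats_subset_Ints)
  then show ?thesis by (metis (no_types, lifting) rangeI subsetD power_one_right)
qed

text \<open>The integrality result is applied to \<open>x\<close> and to \<open>- \<i> * x\<close>,
  whose real part is \<open>Im x\<close>. Thus \<open>2 * Re x\<close> and \<open>2 * Im x\<close>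
  are integers whose squares add up to 4, which leaves only 1, -1, \<i> and -\<i>.\<close>

lemma root_of_unity_gaussian_rationals:
  assumes "x \<in> gaussian_rationals" "x ^ m = 1" "m > 0"
  shows "x ^ 4 = 1"
proof -
  have n: "norm x = 1" using assms by (metis power_eq_1_iff less_not_refl2 norm_one norm_power norm_ge_zero)
  obtain p where p: "2 * Re x = of_int p"
    using double_Re_root_of_unity[OF assms] by (auto elim: Ints_cases)
  have "(- \<i> * x) ^ (4 * m) = ((- \<i>) ^ 4) ^ m * (x ^ m) ^ 4"
    by (simp only: power_mult_distrib mult.commute flip: power_mult)
  then have "(- \<i> * x) ^ (4 * m) = 1"
    by (simp add: assms(2))
  then obtain q where q: "2 * Im x = of_int q"
    using double_Re_root_of_unity[of "- \<i> * x" "4 * m"] assms(3)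
      gaussian_rationals_closed(5)[OF gaussian_rationals_minus_ii assms(1)] by (auto elim: Ints_cases)
  have "(Re x)\<^sup>2 + (Im x)\<^sup>2 = 1" using n by (simp add: cmod_power2 [symmetric])
  then have "(2 * Re x)\<^sup>2 + (2 * Im x)\<^sup>2 = 4" by (simp add: power_mult_distrib)
  then have "real_of_int (p\<^sup>2 + q\<^sup>2) = of_int 4" unfolding p q by simp
  then have pq: "p\<^sup>2 + q\<^sup>2 = 4" by (simp only: of_int_eq_iff)
  have "p\<^sup>2 \<le> 4" using pq zero_le_power2[of q] by linarith
  moreover have "q\<^sup>2 \<le> 4" using pq zero_le_power2[of p] by linarith
  ultimately have "\<bar>p\<bar> \<le> 2" "\<bar>q\<bar> \<le> 2" using abs_le_square_iff[of _ 2] by auto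
  then have "p \<in> {-2,-1,0,1,2}" "q \<in> {-2,-1,0,1,2}" by auto
  then consider "p = 2" "q = 0" | "p = -2" "q = 0" | "p = 0" "q = 2" | "p = 0" "q = -2"
    using pq by auto
  then have "x = 1 \<or> x = -1 \<or> x = \<i> \<or> x = - \<i>"
    using p q by cases (auto simp: complex_eq_iff)
  then show ?thesis by auto
qed

lemma power_4_eq_1_imp_gaussian:
  fixes x :: complex
  assumes "x ^ 4 = 1"
  shows "x \<in> gaussian_rationals"
proof -
  have "(x - 1) * (x + 1) * (x - \<i>) * (x + \<i>) = x ^ 4 - 1"
    by (simp add: algebra_simps eval_nat_numeral)
  then have "x = 1 \<or> x = -1 \<or> x = \<i> \<or> x = -\<i>"
    using assms by (auto simp: eq_neg_iff_add_eq_0)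
  then show ?thesis by (auto simp: gaussian_rationals_iff)
qed

text \<open>By induction the square of \<open>c\<close> is 1, so \<open>c\<close> is 1 or -1, and
  the latter is excluded.\<close>

lemma trivial_roots_of_unity_2_power:
  fixes Z :: "complex set"
  assumes mult: "\<And>a b. a \<in> Z \<Longrightarrow> b \<in> Z \<Longrightarrow> a * b \<in> Z" and "-1 \<notin> Z"
    and "c \<in> Z" "c ^ 2 ^ k = 1"
  shows "c = 1"
  using assms(3,4)
proof (induction k arbitrary: c)
  case (Suc k)
  have "(c * c) ^ 2 ^ k = 1"
    using Suc.prems by (simp add: power_mult power2_eq_square)
  then have "c * c = 1" using Suc.IH[of "c * c"] Suc.prems mult by blast
  then show ?case using Suc.prems assms(2) by (auto simp: square_eq_1_iff)
qed auto

lemma odd_part: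
  assumes "(n::nat) > 0"
  obtains k m where "odd m" "n = 2 ^ k * m"
  using assms
proof (induction n arbitrary: thesis rule: less_induct)
  case (less n)
  show ?case
  proof (cases "odd n")
    case True
    then show ?thesis using less.prems(1)[of n 0] by simp
  next
    case False
    then obtain l where l: "n = 2 * l" by (auto elim: evenE)
    then obtain m k where "odd m" "l = 2 ^ k * m" using less.IH[of l] less.prems(2) by auto
    then show ?thesis using less.prems(1)[of m "Suc k"] l by simp
  qed
qed

lemma power_4_odd_eq_1:
  fixes x :: complex
  assumes "x ^ 4 = 1" "x ^ m = 1" "odd m"
  shows "x = 1"
proof -
  have "x ^ m = x ^ (m mod 4)"
    by (metis assms(1) div_mult_mod_eq mult.commute mult_1 power_add power_mult power_one)
  moreover have "m mod 4 = 1 \<or> m mod 4 = 3" using assms(3) by presburger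
  ultimately have "x = 1 \<or> x ^ 3 = 1" using assms(2) by auto
  moreover have "x ^ 4 = x ^ 3 * x" by (simp add: eval_nat_numeral)
  ultimately show ?thesis using assms(1) by auto
qed

section \<open>Topological groups\<close>

lemma (in group) mult_inv_eq_one_iff:
  "x \<in> carrier G \<Longrightarrow> y \<in> carrier G \<Longrightarrow> x \<otimes> inv y = \<one> \<longleftrightarrow> x = y"
  using inv_solve_right'[of \<one> x y] by auto

lemma topological_group_continuous_mult:
  assumes "topological_group G T" "continuous_map X T f" "continuous_map X T g"
  shows "continuous_map X T (\<lambda>x. f x \<otimes>\<^bsub>G\<^esub> g x)"
proof -
  have "continuous_map X (prod_topology T T) (\<lambda>x. (f x, g x))"
    using assms by (intro continuous_map_pairedI)
  from continuous_map_compose[OF this, of T "\<lambda>(x, y). x \<otimes>\<^bsub>G\<^esub> y"] show ?thesis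
    using assms by (simp add: topological_group_def comp_def)
qed

lemma topological_group_continuous_inv:
  assumes "topological_group G T" "continuous_map X T f"
  shows "continuous_map X T (\<lambda>x. inv\<^bsub>G\<^esub> (f x))"
  using continuous_map_compose[OF assms(2), of T "\<lambda>x. inv\<^bsub>G\<^esub> x"] assms
  by (simp add: topological_group_def comp_def)

lemma topological_group_continuous_left_translation:
  assumes "topological_group G T" "a \<in> carrier G"
  shows "continuous_map T T (\<lambda>x. a \<otimes>\<^bsub>G\<^esub> x)"
  using assms by (intro topological_group_continuous_mult[OF assms(1)])
    (auto simp: topological_group_def)

text \<open>The saturation of an open set is the union of its translates by kernel elements, hence
  open.\<close>

lemma open_map_quotient_hom:
  assumes G: "topological_group G T" and Q: "group Q" and hom: "p \<in> hom G Q"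
    and quot: "quotient_map T TQ p"
  shows "open_map T TQ p"
  unfolding open_map_def
proof (intro allI impI)
  fix U assume U: "openin T U"
  interpret group_hom G Q p
    using G Q hom by (auto simp: group_hom_def group_hom_axioms_def topological_group_def)
  have carr: "topspace T = carrier G" using G by (simp add: topological_group_def)
  have UG: "U \<subseteq> carrier G" using openin_subset[OF U] carr by simp
  have "{x \<in> topspace T. p x \<in> p ` U} = (\<Union>k\<in>kernel G Q p. {x \<in> topspace T. k \<otimes>\<^bsub>G\<^esub> x \<in> U})"
  proof (intro equalityI subsetI)
    fix x assume "x \<in> {x \<in> topspace T. p x \<in> p ` U}"
    then obtain u where u: "u \<in> U" "p x = p u" and x: "x \<in> carrier G" by (auto simp: carr)
    let ?k = "u \<otimes>\<^bsub>G\<^esub> inv\<^bsub>G\<^esub> x"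
    have uG: "u \<in> carrier G" using u UG by auto
    then have "?k \<in> kernel G Q p" using x u(2) by (simp add: kernel_def)
    moreover have "?k \<otimes>\<^bsub>G\<^esub> x = u" using x uG by (simp add: G.m_assoc)
    ultimately show "x \<in> (\<Union>k\<in>kernel G Q p. {x \<in> topspace T. k \<otimes>\<^bsub>G\<^esub> x \<in> U})"
      using u(1) x carr by (auto intro!: bexI[of _ ?k])
  next
    fix x assume "x \<in> (\<Union>k\<in>kernel G Q p. {x \<in> topspace T. k \<otimes>\<^bsub>G\<^esub> x \<in> U})"
    then obtain k where k: "k \<in> kernel G Q p" "k \<otimes>\<^bsub>G\<^esub> x \<in> U" and x: "x \<in> carrier G"
      by (auto simp: carr)
    then have "p (k \<otimes>\<^bsub>G\<^esub> x) = p x" by (auto simp: kernel_def)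
    then show "x \<in> {x \<in> topspace T. p x \<in> p ` U}" using k x carr by (metis (mono_tags, lifting) imageI mem_Collect_eq)
  qed
  moreover have "openin T {x \<in> topspace T. k \<otimes>\<^bsub>G\<^esub> x \<in> U}" if "k \<in> kernel G Q p" for k
    using topological_group_continuous_left_translation[OF G, of k] that U
    by (auto simp: kernel_def intro: openin_continuous_map_preimage)
  ultimately have "openin T {x \<in> topspace T. p x \<in> p ` U}" by auto
  moreover have "p ` U \<subseteq> topspace TQ"
    using openin_subset[OF U] quotient_imp_surjective_map[OF quot] by auto
  ultimately show "openin TQ (p ` U)" using quot by (simp add: quotient_map_def)
qed

text \<open>A product of quotient maps need not be a quotient map in general; for open maps it is
  one, because images of open boxes are open boxes. This lets the continuity of multiplication
  descend to quotient groups.\<close>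

lemma quotient_map_prod_open:
  assumes "quotient_map X Y f" "open_map X Y f"
  shows "quotient_map (prod_topology X X) (prod_topology Y Y) (\<lambda>(x, y). (f x, f y))"
proof (rule continuous_open_imp_quotient_map)
  have c: "continuous_map X Y f" and s: "f ` topspace X = topspace Y"
    using assms(1) by (auto simp: quotient_imp_continuous_map quotient_imp_surjective_map)
  show "continuous_map (prod_topology X X) (prod_topology Y Y) (\<lambda>(x, y). (f x, f y))"
    unfolding case_prod_unfold
    by (intro continuous_map_pairedI continuous_map_compose[OF continuous_map_fst c, unfolded comp_def]
        continuous_map_compose[OF continuous_map_snd c, unfolded comp_def])
  show "(\<lambda>(x, y). (f x, f y)) ` topspace (prod_topology X X) = topspace (prod_topology Y Y)"
    unfolding topspace_prod_topology s[symmetric] by auto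
  show "open_map (prod_topology X X) (prod_topology Y Y) (\<lambda>(x, y). (f x, f y))"
    unfolding open_map_def
  proof (intro allI impI)
    fix U assume U: "openin (prod_topology X X) U"
    show "openin (prod_topology Y Y) ((\<lambda>(x, y). (f x, f y)) ` U)"
      unfolding openin_prod_topology_alt
    proof (intro allI impI)
      fix a b assume "(a, b) \<in> (\<lambda>(x, y). (f x, f y)) ` U"
      then obtain x y where xy: "(x, y) \<in> U" "a = f x" "b = f y" by auto
      from U[unfolded openin_prod_topology_alt, rule_format, OF xy(1)]
      obtain V W where "openin X V" "openin X W" "x \<in> V" "y \<in> W" "V \<times> W \<subseteq> U"
        by auto
      then show "\<exists>V W. openin Y V \<and> openin Y W \<and> a \<in> V \<and> b \<in> W \<and> V \<times> W \<subseteq> (\<lambda>(x, y). (f x, f y)) ` U"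
        using assms(2) xy unfolding open_map_def
        by (intro exI[of _ "f ` V"] exI[of _ "f ` W"] conjI) auto
    qed
  qed
qed

text \<open>Multiplication and inversion are continuous because they are so after composition with
  the quotient maps from \<open>G\<close>. A closed kernel makes the identity of \<open>Q\<close> a
  closed point, and the diagonal is its preimage under \<open>x \<otimes> inv y\<close>.\<close>

lemma hausdorff_group_quotient_hom:
  assumes G: "topological_group G T" and Q: "group Q" and hom: "p \<in> hom G Q"
    and quot: "quotient_map T TQ p" and Qt: "topspace TQ = carrier Q"
    and ker: "closedin T (kernel G Q p)"
  shows "hausdorff_group Q TQ"
proof -
  interpret group_hom G Q p
    using G Q hom by (auto simp: group_hom_def group_hom_axioms_def topological_group_def)
  have carr: "topspace T = carrier G" using G by (simp add: topological_group_def)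
  have p: "continuous_map T TQ p" using quot by (rule quotient_imp_continuous_map)
  have "continuous_map (prod_topology T T) TQ (\<lambda>z. p (fst z \<otimes>\<^bsub>G\<^esub> snd z))"
    by (rule continuous_map_compose[OF _ p, unfolded comp_def])
      (auto intro!: topological_group_continuous_mult[OF G] continuous_map_fst continuous_map_snd)
  then have "continuous_map (prod_topology T T) TQ ((\<lambda>(x, y). x \<otimes>\<^bsub>Q\<^esub> y) \<circ> (\<lambda>(x, y). (p x, p y)))"
    by (rule continuous_map_eq) (auto simp: carr)
  then have m: "continuous_map (prod_topology TQ TQ) TQ (\<lambda>(x, y). x \<otimes>\<^bsub>Q\<^esub> y)"
    by (rule continuous_compose_quotient_map[OF quotient_map_prod_open[OF quot open_map_quotient_hom[OF G Q hom quot]]])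
  have "continuous_map T TQ (\<lambda>x. p (inv\<^bsub>G\<^esub> x))"
    by (rule continuous_map_compose[OF _ p, unfolded comp_def])
      (auto intro!: topological_group_continuous_inv[OF G])
  then have "continuous_map T TQ ((\<lambda>x. inv\<^bsub>Q\<^esub> x) \<circ> p)"
    by (rule continuous_map_eq) (auto simp: carr)
  then have i: "continuous_map TQ TQ (\<lambda>x. inv\<^bsub>Q\<^esub> x)"
    by (rule continuous_compose_quotient_map[OF quot])
  have tg: "topological_group Q TQ"
    using m i Q Qt by (simp add: topological_group_def)
  have "{x \<in> topspace T. p x \<in> {\<one>\<^bsub>Q\<^esub>}} = kernel G Q p"
    by (auto simp: kernel_def carr)
  then have one: "closedin TQ {\<one>\<^bsub>Q\<^esub>}"
    using quot ker Qt unfolding quotient_map_closedin by (metis H.one_closed empty_subsetI insert_subset)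
  have "continuous_map (prod_topology TQ TQ) TQ (\<lambda>z. fst z \<otimes>\<^bsub>Q\<^esub> inv\<^bsub>Q\<^esub> (snd z))"
    by (intro topological_group_continuous_mult[OF tg] topological_group_continuous_inv[OF tg]
        continuous_map_fst continuous_map_snd)
  from closedin_continuous_map_preimage[OF this one]
  have "closedin (prod_topology TQ TQ) {z \<in> topspace (prod_topology TQ TQ). fst z \<otimes>\<^bsub>Q\<^esub> inv\<^bsub>Q\<^esub> (snd z) \<in> {\<one>\<^bsub>Q\<^esub>}}" .
  also have "{z \<in> topspace (prod_topology TQ TQ). fst z \<otimes>\<^bsub>Q\<^esub> inv\<^bsub>Q\<^esub> (snd z) \<in> {\<one>\<^bsub>Q\<^esub>}}
      = (\<lambda>x. (x, x)) ` topspace TQ"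
    by (auto simp: Qt image_iff H.mult_inv_eq_one_iff)
  finally show ?thesis
    using tg by (simp add: hausdorff_group_def Hausdorff_space_closedin_diagonal)
qed

section \<open>Factor groups, pullbacks along injective homomorphisms, and comparison of group
  topologies\<close>

lemma kernel_r_coset:
  assumes "N \<lhd> G"
  shows "kernel G (G Mod N) (\<lambda>x. N #>\<^bsub>G\<^esub> x) = N"
proof -
  interpret normal N G by fact
  show ?thesis
    using rcos_self[OF _ subgroup_axioms] coset_join2[OF _ subgroup_axioms] subset
    by (auto simp: kernel_def FactGroup_def)
qed

lemma hausdorff_group_FactGroup:
  assumes "topological_group G T" "N \<lhd> G" "closedin T N"
  shows "hausdorff_group (G Mod N) (quotient_group_topology G T N)"
proof -
  interpret normal N G by fact
  have T: "topspace T = carrier G" using assms(1) by (simp add: topological_group_def)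
  show ?thesis
    using assms T kernel_r_coset[OF assms(2)]
    by (intro hausdorff_group_quotient_hom[of G T _ "\<lambda>x. N #>\<^bsub>G\<^esub> x"])
      (auto simp: factorgroup_is_group r_coset_hom_Mod quotient_map_quotient_group_topology
        topspace_quotient_group_topology)
qed

text \<open>This supplies the competing topology in the failure of minimality, with \<open>j\<close>
  an embedding into a quotient of SL(n, \<complex>).\<close>

lemma hausdorff_group_pullback:
  assumes G: "hausdorff_group G T" and Q: "group Q" and hom: "j \<in> hom Q G" and inj: "inj_on j (carrier Q)"
  shows "hausdorff_group Q (pullback_topology (carrier Q) j T)"
proof -
  let ?S = "pullback_topology (carrier Q) j T"
  interpret group_hom Q G j
    using G Q hom by (auto simp: group_hom_def group_hom_axioms_def hausdorff_group_def topological_group_def)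
  have tg: "topological_group G T" and T: "topspace T = carrier G"
    using G by (auto simp: hausdorff_group_def topological_group_def)
  have S: "topspace ?S = carrier Q" using T by (auto simp: topspace_pullback_topology)
  have j: "continuous_map ?S T j"
    using continuous_map_pullback[of T T id "carrier Q" j] by (simp add: comp_def)
  have jf: "continuous_map (prod_topology ?S ?S) T (\<lambda>z. j (fst z))"
    by (rule continuous_map_compose[OF continuous_map_fst j, unfolded comp_def])
  have js: "continuous_map (prod_topology ?S ?S) T (\<lambda>z. j (snd z))"
    by (rule continuous_map_compose[OF continuous_map_snd j, unfolded comp_def])
  have "continuous_map (prod_topology ?S ?S) T (j \<circ> (\<lambda>(x, y). x \<otimes>\<^bsub>Q\<^esub> y))"
    by (rule continuous_map_eq[OF topological_group_continuous_mult[OF tg jf js]]) (auto simp: S)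
  then have m: "continuous_map (prod_topology ?S ?S) ?S (\<lambda>(x, y). x \<otimes>\<^bsub>Q\<^esub> y)"
    by (rule continuous_map_pullback') (auto simp: S)
  have "continuous_map ?S T (j \<circ> (\<lambda>x. inv\<^bsub>Q\<^esub> x))"
    by (rule continuous_map_eq[OF topological_group_continuous_inv[OF tg j]]) (auto simp: S)
  then have i: "continuous_map ?S ?S (\<lambda>x. inv\<^bsub>Q\<^esub> x)"
    by (rule continuous_map_pullback') (auto simp: S)
  have "Hausdorff_space ?S"
    by (rule Hausdorff_space_injective_preimage[OF _ j]) (use G inj S in \<open>auto simp: hausdorff_group_def\<close>)
  then show ?thesis using m i Q S by (simp add: hausdorff_group_def topological_group_def)
qed

text \<open>Left translations are continuous for both topologies, so it suffices to compare
  neighbourhoods of the identity.\<close>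

lemma openin_topological_group_transfer:
  assumes S: "topological_group Q S" and T: "topological_group Q T"
    and nbhd: "\<And>U. openin T U \<Longrightarrow> \<one>\<^bsub>Q\<^esub> \<in> U \<Longrightarrow> \<exists>V. openin S V \<and> \<one>\<^bsub>Q\<^esub> \<in> V \<and> V \<subseteq> U"
    and U: "openin T U"
  shows "openin S U"
proof (subst openin_subopen, intro ballI)
  interpret group Q using S by (simp add: topological_group_def)
  have top: "topspace S = carrier Q" "topspace T = carrier Q"
    using S T by (auto simp: topological_group_def)
  fix x assume x: "x \<in> U"
  then have xQ: "x \<in> carrier Q" using openin_subset[OF U] top by auto
  have "openin T {y \<in> topspace T. x \<otimes>\<^bsub>Q\<^esub> y \<in> U}"
    using topological_group_continuous_left_translation[OF T xQ] U by (rule openin_continuous_map_preimage)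
  from nbhd[OF this] obtain V where V: "openin S V" "\<one>\<^bsub>Q\<^esub> \<in> V" "V \<subseteq> {y \<in> topspace T. x \<otimes>\<^bsub>Q\<^esub> y \<in> U}"
    using x xQ top by auto
  let ?W = "{z \<in> topspace S. inv\<^bsub>Q\<^esub> x \<otimes>\<^bsub>Q\<^esub> z \<in> V}"
  have "openin S ?W"
    using topological_group_continuous_left_translation[OF S] xQ V(1)
    by (intro openin_continuous_map_preimage) auto
  moreover have "x \<in> ?W" using xQ V(2) top by simp
  moreover have "?W \<subseteq> U"
  proof
    fix z assume z: "z \<in> ?W"
    then have "x \<otimes>\<^bsub>Q\<^esub> (inv\<^bsub>Q\<^esub> x \<otimes>\<^bsub>Q\<^esub> z) \<in> U" using V(3) by auto
    then show "z \<in> U" using xQ z top by (simp add: m_assoc[symmetric])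
  qed
  ultimately show "\<exists>W. openin S W \<and> x \<in> W \<and> W \<subseteq> U" by blast
qed

lemma topological_group_nbhd_mult:
  assumes G: "topological_group G T" and U: "openin T U" "\<one>\<^bsub>G\<^esub> \<in> U"
  shows "\<exists>V. openin T V \<and> \<one>\<^bsub>G\<^esub> \<in> V \<and> (\<forall>a\<in>V. \<forall>b\<in>V. a \<otimes>\<^bsub>G\<^esub> b \<in> U)"
proof -
  interpret group G using G by (simp add: topological_group_def)
  have T: "topspace T = carrier G" using G by (simp add: topological_group_def)
  have "continuous_map (prod_topology T T) T (\<lambda>z. fst z \<otimes>\<^bsub>G\<^esub> snd z)"
    by (intro topological_group_continuous_mult[OF G] continuous_map_fst continuous_map_snd)
  from openin_continuous_map_preimage[OF this U(1)]
  have "openin (prod_topology T T) {z \<in> topspace (prod_topology T T). fst z \<otimes>\<^bsub>G\<^esub> snd z \<in> U}" .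
  from this[unfolded openin_prod_topology_alt, rule_format, of "\<one>\<^bsub>G\<^esub>" "\<one>\<^bsub>G\<^esub>"]
  obtain A B where AB: "openin T A" "openin T B" "\<one>\<^bsub>G\<^esub> \<in> A" "\<one>\<^bsub>G\<^esub> \<in> B"
    "A \<times> B \<subseteq> {z \<in> topspace (prod_topology T T). fst z \<otimes>\<^bsub>G\<^esub> snd z \<in> U}"
    using U T by auto
  then show ?thesis
    by (intro exI[of _ "A \<inter> B"]) auto
qed

lemma topological_group_nbhd_conj:
  assumes G: "topological_group G T" and U: "openin T U" "\<one>\<^bsub>G\<^esub> \<in> U"
  shows "\<exists>V. openin T V \<and> \<one>\<^bsub>G\<^esub> \<in> V \<and> (\<forall>a\<in>V. \<forall>b\<in>V. \<forall>c\<in>V. a \<otimes>\<^bsub>G\<^esub> b \<otimes>\<^bsub>G\<^esub> inv\<^bsub>G\<^esub> c \<in> U)"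
proof -
  interpret group G using G by (simp add: topological_group_def)
  have T: "topspace T = carrier G" using G by (simp add: topological_group_def)
  obtain V where V: "openin T V" "\<one>\<^bsub>G\<^esub> \<in> V" "\<And>a b. a \<in> V \<Longrightarrow> b \<in> V \<Longrightarrow> a \<otimes>\<^bsub>G\<^esub> b \<in> U"
    using topological_group_nbhd_mult[OF G U] by blast
  obtain W where W: "openin T W" "\<one>\<^bsub>G\<^esub> \<in> W" "\<And>a b. a \<in> W \<Longrightarrow> b \<in> W \<Longrightarrow> a \<otimes>\<^bsub>G\<^esub> b \<in> V"
    using topological_group_nbhd_mult[OF G V(1,2)] by blast
  let ?I = "{x \<in> topspace T. inv\<^bsub>G\<^esub> x \<in> V}"
  have "openin T ?I"
    using G V(1) by (intro openin_continuous_map_preimage) (auto simp: topological_group_def)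
  then show ?thesis
    using V W T by (intro exI[of _ "W \<inter> ?I"]) auto
qed

section \<open>Large conjugates and limits of transvections\<close>

lemma mat_nth: "mat c $ i $ j = (if i = j then c else 0)"
  by (simp add: mat_def)

lemma matrix_add_mult_distrib: "(A + B) ** C = A ** C + B ** (C :: 'a::semiring_1^'n^'m)"
  by (simp add: matrix_matrix_mult_def vec_eq_iff distrib_right sum.distrib)

lemma norm_det_le:
  fixes A :: "complex^'n^'n"
  assumes "\<And>i j. norm (A $ i $ j) \<le> x"
  shows "norm (det A) \<le> fact CARD('n) * x ^ CARD('n)"
proof -
  let ?P = "{p. p permutes (UNIV :: 'n set)}"
  have "norm (det A) \<le> (\<Sum>p\<in>?P. norm (of_int (sign p) * (\<Prod>i\<in>UNIV. A $ i $ p i)))"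
    unfolding det_def by (rule norm_sum)
  also have "\<dots> \<le> (\<Sum>p\<in>?P. x ^ CARD('n))"
  proof (rule sum_mono)
    fix p
    have "norm (of_int (sign p) * (\<Prod>i\<in>UNIV. A $ i $ p i)) = (\<Prod>i\<in>UNIV. norm (A $ i $ p i))"
      by (simp add: norm_mult prod_norm sign_def)
    also have "\<dots> \<le> (\<Prod>i\<in>(UNIV :: 'n set). x)"
      using assms by (intro prod_mono) auto
    finally show "norm (of_int (sign p) * (\<Prod>i\<in>UNIV. A $ i $ p i)) \<le> x ^ CARD('n)" by simp
  qed
  also have "\<dots> = fact CARD('n) * x ^ CARD('n)"
    by (simp add: card_permutations)
  finally show ?thesis .
qed

text \<open>If the entries of all rank-one matrices \<open>g E\<^sub>i\<^sub>j g\<^sup>-\<^sup>1\<close> with \<open>i \<noteq> j\<close> are at most \<open>C\<close> and \<open>g\<close>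
  had a large entry, then every entry of \<open>g\<^sup>-\<^sup>1\<close> would be small, against \<open>det g\<^sup>-\<^sup>1 = 1\<close>.\<close>

lemma entries_bounded_by_conjugates:
  fixes g :: "complex^'n^'n"
  assumes det: "det g = 1" and C: "C \<ge> 1"
    and bound: "\<And>i j a b. i \<noteq> j \<Longrightarrow> norm (g $ a $ i) * norm (cramer_inverse g $ j $ b) \<le> C"
  shows "norm (g $ a $ i) \<le> fact CARD('n) * (real CARD('n) * C\<^sup>2)"
proof (rule ccontr)
  define h where "h = cramer_inverse g"
  define n where "n = real CARD('n)"
  have n1: "n \<ge> 1" unfolding n_def using zero_less_card_finite[where 'a='n] by linarith
  define L where "L = norm (g $ a $ i)"
  assume "\<not> ?thesis"
  then have L: "L > fact CARD('n) * (n * C\<^sup>2)" by (simp add: L_def n_def)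
  have "C * 1 \<le> C * C" using C by (intro mult_left_mono) auto
  then have CC: "C \<le> C\<^sup>2" by (simp add: power2_eq_square)
  then have "1 * C\<^sup>2 \<le> n * C\<^sup>2" using n1 by (intro mult_right_mono) auto
  then have C2: "n * C\<^sup>2 \<ge> 1" "C \<le> n * C\<^sup>2" using C CC by linarith+
  have nL: "n * C\<^sup>2 < L"
    using L C2 mult_mono[of 1 "fact CARD('n)" "n * C\<^sup>2" "n * C\<^sup>2"] by (simp add: fact_ge_1)
  have Lpos: "L > 0" "L > 1" using nL C2 by linarith+
  define x where "x = n * C\<^sup>2 / L"
  have x: "x \<ge> 0" "x < 1" using C2 nL Lpos by (auto simp: x_def)
  have hg: "h ** g = mat 1" and deth: "det h = 1"
    using mult_cramer_inverse[OF det] by (auto simp: h_def)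
  show False
  proof (cases "\<exists>j0. j0 \<noteq> i")
    case False
    \<comment> \<open>For 1 by 1 matrices the hypothesis on pairs of distinct indices is vacuous;
      instead the determinant forces the single entry to be 1, below the assumed size.\<close>
    then have U: "(UNIV :: 'n set) = {i}" by auto
    have "det g = (\<Prod>i\<in>UNIV. g $ i $ i)"
      using False by (intro det_diagonal) metis
    then have "g $ i $ i = 1" using det by (simp add: U)
    moreover have "a = i" using False by auto
    ultimately have "L = 1" by (simp add: L_def)
    then show False using Lpos by simp
  next
    case True
    then obtain j0 where j0: "j0 \<noteq> i" by auto
    have row: "norm (h $ j $ b) \<le> C / L" if "j \<noteq> i" for j b
      using bound[of i j a b] that Lpos by (simp add: L_def h_def field_simps)
    \<comment> \<open>The large entry in column \<open>i\<close> of \<open>g\<close> bounds every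
      row of \<open>h\<close> except row \<open>i\<close>. To reach row \<open>i\<close>, a large
      entry of \<open>g\<close> in another column \<open>j0\<close> is needed: some summand of the
      diagonal entry 1 of \<open>h\<close> times \<open>g\<close> has size at least
      \<open>1 / n\<close>, and its factor from \<open>h\<close> is small.\<close>
    have "\<exists>b. norm (h $ j0 $ b * g $ b $ j0) \<ge> 1 / n"
    proof (rule ccontr)
      assume "\<not> ?thesis"
      then have less: "norm (h $ j0 $ b * g $ b $ j0) < 1 / n" for b by (simp add: not_le)
      have "1 = norm ((h ** g) $ j0 $ j0)" by (simp add: hg mat_def)
      also have "\<dots> \<le> (\<Sum>b\<in>UNIV. norm (h $ j0 $ b * g $ b $ j0))"
        unfolding matrix_matrix_mult_def by (simp add: norm_sum)
      also have "\<dots> < (\<Sum>b\<in>(UNIV :: 'n set). 1 / n)"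
        using less by (intro sum_strict_mono) auto
      also have "\<dots> = 1" using n1 by (simp add: n_def)
      finally show False by simp
    qed
    then obtain b where b: "1 / n \<le> norm (h $ j0 $ b) * norm (g $ b $ j0)" by (auto simp: norm_mult)
    also have "\<dots> \<le> C / L * norm (g $ b $ j0)" by (intro mult_right_mono row j0) auto
    finally have gb: "L / (n * C) \<le> norm (g $ b $ j0)"
      using n1 C Lpos by (simp add: field_simps)
    have "norm (h $ i $ b') \<le> x" for b'
    proof -
      have "L / (n * C) * norm (h $ i $ b') \<le> norm (g $ b $ j0) * norm (h $ i $ b')"
        by (intro mult_right_mono gb) auto
      also have "\<dots> \<le> C" using bound[OF j0] by (simp add: h_def)
      finally show ?thesis using n1 C Lpos by (simp add: x_def field_simps power2_eq_square)
    qed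
    moreover have "C / L \<le> x" using C2(2) Lpos by (simp add: x_def divide_right_mono)
    ultimately have "norm (h $ j $ b) \<le> x" for j b
      using row[of j b] by (cases "j = i") auto
    then have "1 \<le> fact CARD('n) * x ^ CARD('n)"
      using norm_det_le[of h x] deth by simp
    also have "\<dots> \<le> fact CARD('n) * x ^ 1"
      using x by (intro mult_left_mono power_decreasing) (auto simp: Suc_le_eq)
    also have "\<dots> < 1" using L Lpos by (simp add: x_def field_simps)
    finally show False by simp
  qed
qed

lemma norm_matrix_le_sum: "norm (A :: complex^'n^'m) \<le> (\<Sum>i\<in>UNIV. \<Sum>j\<in>UNIV. norm (A $ i $ j))"
proof -
  have "norm A \<le> (\<Sum>i\<in>UNIV. norm (A $ i))"
    unfolding norm_vec_def by (rule L2_set_le_sum) auto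
  also have "\<dots> \<le> (\<Sum>i\<in>UNIV. \<Sum>j\<in>UNIV. norm (A $ i $ j))"
    unfolding norm_vec_def[of "A $ _"] by (intro sum_mono L2_set_le_sum) auto
  finally show ?thesis .
qed

lemma norm_matrix_nth_le:
  fixes A :: "complex^'n^'m"
  shows "norm (A $ i $ j) \<le> norm A"
  using Finite_Cartesian_Product.norm_nth_le[of "A $ i" j] Finite_Cartesian_Product.norm_nth_le[of A i]
  by linarith

text \<open>The contrapositive of \<open>entries_bounded_by_conjugates\<close>. The product in the
  conclusion is the norm of an entry of \<open>g E\<^sub>i\<^sub>j g\<^sup>-\<^sup>1\<close>, so
  conjugation by elements of an unbounded set can enlarge a small transvection arbitrarily.\<close>

lemma unbounded_imp_large_conjugate:
  fixes V :: "(complex^'n^'n) set"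
  assumes det: "\<And>g. g \<in> V \<Longrightarrow> det g = 1" and unb: "\<not> bounded V"
  shows "\<exists>g\<in>V. \<exists>i j a b. i \<noteq> j \<and> norm (g $ a $ i) * norm (cramer_inverse g $ j $ b) > C"
proof (rule ccontr)
  assume *: "\<not> ?thesis"
  define D where "D = max C 1"
  have "norm (g $ a $ i) \<le> fact CARD('n) * (real CARD('n) * D\<^sup>2)" if "g \<in> V" for g a i
  proof (rule entries_bounded_by_conjugates[OF det[OF that]])
    show "D \<ge> 1" by (simp add: D_def)
    show "norm (g $ a $ i) * norm (cramer_inverse g $ j $ b) \<le> D" if "i \<noteq> j" for i j a b
    proof -
      have "\<not> C < norm (g $ a $ i) * norm (cramer_inverse g $ j $ b)"
        using * \<open>g \<in> V\<close> that by blast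
      then show ?thesis by (simp add: D_def)
    qed
  qed
  then have "norm g \<le> (\<Sum>i\<in>(UNIV::'n set). \<Sum>j\<in>(UNIV::'n set). fact CARD('n) * (real CARD('n) * D\<^sup>2))" if "g \<in> V" for g
    using that by (intro order_trans[OF norm_matrix_le_sum] sum_mono) auto
  then have "bounded V" unfolding bounded_iff by blast
  then show False using unb by simp
qed

lemma conj_transvection_by_inverse:
  assumes "g ** h = mat 1"
  shows "g ** transvection i j t ** h = mat 1 + mat t ** (\<chi> a b. g $ a $ i * h $ j $ b)"
proof -
  have "(g ** transvection i j t ** h) $ a $ b = (g ** h) $ a $ b + t * (g $ a $ i * h $ j $ b)" for a b
    unfolding mult_transvection
    by (simp add: matrix_matrix_mult_def distrib_right sum.distrib if_distrib [of "\<lambda>x. x * _"] cong: if_cong)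
  then show ?thesis by (simp add: vec_eq_iff assms)
qed

text \<open>The matrix is \<open>g E\<^sub>i\<^sub>j h\<close>, and \<open>E\<^sub>i\<^sub>j\<close>
  squares to 0 off the diagonal.\<close>

lemma conj_unit_square_zero:
  fixes g h :: "'a::comm_ring_1^'n^'n"
  assumes "h ** g = mat 1" "i \<noteq> j"
  shows "(\<chi> a b. g $ a $ i * h $ j $ b) ** (\<chi> a b. g $ a $ i * h $ j $ b) = 0"
proof -
  have "(\<Sum>k\<in>UNIV. g $ a $ i * h $ j $ k * (g $ k $ i * h $ j $ b)) = g $ a $ i * (h ** g) $ j $ i * h $ j $ b" for a b
    by (simp add: matrix_matrix_mult_def sum_distrib_left sum_distrib_right mult_ac)
  then show ?thesis
    using assms by (simp add: matrix_matrix_mult_def vec_eq_iff mat_def)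
qed

lemma bounded_arithmetic_progression:
  fixes p q :: complex
  assumes "\<And>k::nat. norm (p + of_nat k * q) \<le> B"
  shows "q = 0"
proof (rule ccontr)
  assume "q \<noteq> 0"
  obtain k :: nat where k: "real k > (B + norm p) / norm q" using reals_Archimedean2 by blast
  then have "real k * norm q > B + norm p" using \<open>q \<noteq> 0\<close> by (simp add: field_simps)
  moreover have "norm (of_nat k * q) \<le> norm (p + of_nat k * q) + norm p"
    by (metis add_diff_cancel_left' norm_triangle_ineq4)
  ultimately show False using assms[of k] by (simp add: norm_mult)
qed

text \<open>The entry \<open>(i, i)\<close> of the conjugate is
  \<open>A $ i $ i + k * A $ j $ i\<close>, so boundedness in \<open>k\<close> kills
  \<open>A $ j $ i\<close>. After that the entry \<open>(i, j)\<close> is linear in \<open>k\<close>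
  with slope \<open>A $ j $ j - A $ i $ i\<close>.\<close>

lemma bounded_normalized_imp_scalar:
  fixes M :: "(complex^'n^'n) set"
  assumes bnd: "bounded M"
    and conj: "\<And>A i j (k::nat). A \<in> M \<Longrightarrow> i \<noteq> j \<Longrightarrow>
      transvection i j (of_nat k) ** A ** transvection i j (- of_nat k) \<in> M"
    and A: "A \<in> M"
  obtains c where "A = mat c"
proof -
  obtain B where B: "\<And>X. X \<in> M \<Longrightarrow> norm X \<le> B" using bnd by (auto simp: bounded_iff)
  have entry: "norm ((transvection i j (of_nat k) ** A ** transvection i j (- of_nat k)) $ a $ b) \<le> B"
    if "i \<noteq> j" for i j a b and k :: nat
    using B[OF conj[OF A that]] norm_matrix_nth_le order_trans by blast
  have off: "A $ j $ i = 0" if "i \<noteq> j" for i j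
    by (rule bounded_arithmetic_progression[of "A $ i $ i" _ B])
      (use entry[OF that, of _ i i] that in \<open>simp add: conj_transvection_nth\<close>)
  have diag: "A $ i $ i = A $ j $ j" if "i \<noteq> j" for i j
  proof -
    have "A $ j $ j - A $ i $ i = 0"
      by (rule bounded_arithmetic_progression[of "A $ i $ j" _ B])
        (use entry[OF that, of _ i j] off[OF that] in \<open>simp add: conj_transvection_nth algebra_simps\<close>)
    then show ?thesis by simp
  qed
  obtain k :: 'n where True by simp
  have "A = mat (A $ k $ k)"
    using off diag[of _ k] by (auto simp: vec_eq_iff mat_nth) metis
  then show ?thesis by (rule that)
qed

lemma mat_mult_mat_mult:
  fixes X :: "complex^'n^'n"
  shows "(mat s ** X) ** (mat t ** Y) = mat (s * t) ** (X ** Y)"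
proof -
  have c: "X ** mat t = mat t ** X" by (simp add: vec_eq_iff mult.commute)
  have "(mat s ** X) ** (mat t ** Y) = mat s ** (X ** mat t) ** Y" by (simp add: matrix_mul_assoc)
  also have "\<dots> = mat s ** (mat t ** (X ** Y))" unfolding c by (simp add: matrix_mul_assoc)
  finally show ?thesis by (simp add: vec_eq_iff mult.assoc)
qed

lemma mat_1_add_mult:
  fixes X :: "complex^'n^'n"
  assumes "X ** X = 0"
  shows "(mat 1 + mat s ** X) ** (mat 1 + mat t ** X) = mat 1 + mat (s + t) ** X"
proof -
  have "(mat s ** X) ** (mat t ** X) = 0" by (simp add: mat_mult_mat_mult assms vec_eq_iff)
  then show ?thesis
    by (simp add: matrix_add_ldistrib matrix_add_mult_distrib) (simp add: vec_eq_iff algebra_simps)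
qed

lemma continuous_on_matrix_mult [continuous_intros]:
  fixes f g :: "'b::topological_space \<Rightarrow> complex^'n^'n"
  assumes "continuous_on S f" "continuous_on S g"
  shows "continuous_on S (\<lambda>x. f x ** g x)"
  unfolding matrix_matrix_mult_def by (intro continuous_intros assms)

lemma continuous_on_mat [continuous_intros]:
  fixes f :: "'b::topological_space \<Rightarrow> complex"
  assumes "continuous_on S f"
  shows "continuous_on S (\<lambda>x. mat (f x) :: complex^'n^'n)"
  unfolding mat_def
  apply (intro continuous_intros)
  subgoal for i j by (cases "i = j") (auto intro!: continuous_intros assms)
  done

text \<open>Conjugating \<open>1 + s X\<close> by \<open>1 + k E\<^sub>i\<^sub>j\<close> and letting \<open>k\<close> tend to infinity with \<open>s\<close> of order
  \<open>k\<^sup>-\<^sup>2\<close> isolates the quadratic term, which is a multiple of \<open>E\<^sub>i\<^sub>j\<close>.\<close>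

lemma limit_transvection:
  fixes M :: "(complex^'n^'n) set"
  assumes cl: "closed M"
    and conj: "\<And>A i j (k::nat). A \<in> M \<Longrightarrow> i \<noteq> j \<Longrightarrow>
      transvection i j (of_nat k) ** A ** transvection i j (- of_nat k) \<in> M"
    and X: "\<And>s. mat 1 + mat s ** X \<in> M" and ij: "i \<noteq> j" and nz: "X $ j $ i \<noteq> 0"
  shows "transvection i j c \<in> M"
proof -
  \<comment> \<open>With \<open>s = q / m\<^sup>2\<close> and \<open>m = k + 1\<close>, the
    quadratic term \<open>- m\<^sup>2 * s * X $ j $ i\<close> of the conjugate equals
    \<open>c\<close> exactly, while all other perturbations tend to 0. The shift by one avoids
    division by 0.\<close>
  define q where "q = - c / X $ j $ i"
  define r :: "nat \<Rightarrow> complex" where "r k = 1 / of_nat (Suc k)" for k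
  define Y where "Y k = transvection i j (of_nat (Suc k)) ** (mat 1 + mat (q * (r k * r k)) ** X)
    ** transvection i j (- of_nat (Suc k))" for k
  have YM: "Y k \<in> M" for k unfolding Y_def by (intro conj X ij)
  have r: "r \<longlonglongrightarrow> 0"
    unfolding r_def using LIMSEQ_Suc[OF lim_1_over_n[where 'a=complex]] by simp
  have "(\<lambda>k. Y k $ a $ b) \<longlonglongrightarrow> transvection i j c $ a $ b" for a b
  proof -
    let ?R = "\<lambda>x. (x * x * X $ a $ b + (if a = i then x * X $ j $ b else 0)
        - (if b = j then x * X $ a $ i else 0))"
    have "Y k $ a $ b = transvection i j c $ a $ b + q * ?R (r k)" for k
    proof -
      define m :: complex where "m = of_nat (Suc k)"
      define s where "s = q * (r k * r k)"
      have "m \<noteq> 0" unfolding m_def by (simp only: of_nat_eq_0_iff)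
      then have mr: "m * r k = 1" by (simp add: r_def m_def)
      have 1: "m * (s * x) = q * (r k * x)" for x
      proof -
        have "m * (s * x) = (m * r k) * (q * (r k * x))" by (simp add: s_def)
        then show ?thesis by (simp add: mr)
      qed
      have 2: "m * m * (s * X $ j $ i) = - c"
      proof -
        have "m * m * (s * X $ j $ i) = (m * r k) * (m * r k) * (q * X $ j $ i)" by (simp add: s_def)
        then show ?thesis using nz by (simp add: mr q_def)
      qed
      have "Y k $ a $ b = mat 1 $ a $ b + (s * X $ a $ b + (if a = i then m * (s * X $ j $ b) else 0)
          - (if b = j then m * (s * X $ a $ i) else 0) - (if a = i \<and> b = j then m * m * (s * X $ j $ i) else 0))"
        unfolding Y_def m_def[symmetric] s_def[symmetric] conj_transvection_nth using ij
        by (simp add: mat_nth algebra_simps)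
      also have "\<dots> = transvection i j c $ a $ b + q * ?R (r k)"
        unfolding 1 2 by (simp add: s_def transvection_def mat_nth algebra_simps)
      finally show ?thesis .
    qed
    moreover have "(\<lambda>k. transvection i j c $ a $ b + q * ?R (r k))
        \<longlonglongrightarrow> transvection i j c $ a $ b + q * ?R 0"
      by (cases "a = i"; cases "b = j"; simp only: if_True if_False simp_thms; intro tendsto_intros r)
    ultimately show ?thesis by (simp cong: if_cong)
  qed
  then have "Y \<longlonglongrightarrow> transvection i j c" by (intro vec_tendstoI)
  then show ?thesis using closed_sequentially[OF cl] YM by blast
qed

text \<open>Since \<open>X\<close> squares to 0, \<open>1 + s X\<close> is additive in
  \<open>s\<close>; multiples remove the bound on \<open>s\<close>, and density of \<rat>(\<i>) with
  closedness of \<open>M\<close> gives all complex \<open>s\<close>. Then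
  \<open>limit_transvection\<close> yields one family of transvections, and applying it again
  spreads this to all index pairs.\<close>

lemma all_transvections:
  fixes M :: "(complex^'n^'n) set"
  assumes cl: "closed M" and mult: "\<And>A B. A \<in> M \<Longrightarrow> B \<in> M \<Longrightarrow> A ** B \<in> M"
    and one: "mat 1 \<in> M"
    and conj: "\<And>A i j (k::nat). A \<in> M \<Longrightarrow> i \<noteq> j \<Longrightarrow>
      transvection i j (of_nat k) ** A ** transvection i j (- of_nat k) \<in> M"
    and sq: "X ** X = 0" and nz: "X \<noteq> 0"
    and X: "\<And>s. s \<in> gaussian_rationals \<Longrightarrow> norm s \<le> 1 \<Longrightarrow> mat 1 + mat s ** X \<in> M"
    and ij: "i \<noteq> j"
  shows "transvection i j c \<in> M"
proof -
  have limit: "transvection i j c \<in> M"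
    if "\<And>s. mat 1 + mat s ** X \<in> M" "i \<noteq> j" "X $ j $ i \<noteq> 0" for X i j c
    by (rule limit_transvection[OF cl _ that]) (rule conj)
  have multiple: "mat 1 + mat (of_nat k * s) ** X \<in> M" if "mat 1 + mat s ** X \<in> M" for k s
  proof (induction k)
    case 0
    have "mat 1 + mat (of_nat 0 * s) ** X = mat 1" by (simp add: vec_eq_iff)
    then show ?case using one by simp
  next
    case (Suc k)
    from mult[OF this that] show ?case
      by (simp add: mat_1_add_mult[OF sq] distrib_right add.commute)
  qed
  have "mat 1 + mat s ** X \<in> M" if s: "s \<in> gaussian_rationals" for s
  proof -
    obtain k :: nat where k: "real k > norm s" "k > 0"
      using reals_Archimedean2[of "norm s"] le_less_trans[OF norm_ge_zero] by (metis of_nat_0_less_iff)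
    have "s / of_nat k \<in> gaussian_rationals"
      using s by (auto simp: gaussian_rationals_iff)
    moreover have "norm (s / of_nat k) \<le> 1" using k by (simp add: norm_divide)
    ultimately have "mat 1 + mat (of_nat k * (s / of_nat k)) ** X \<in> M"
      using X multiple by blast
    then show ?thesis using k by simp
  qed
  moreover have "closed ((\<lambda>s. mat 1 + mat s ** X) -` M)"
    by (rule closed_vimage[OF cl]) (intro continuous_intros)
  ultimately have "closure gaussian_rationals \<subseteq> (\<lambda>s. mat 1 + mat s ** X) -` M"
    by (intro closure_minimal) auto
  then have Xall: "mat 1 + mat s ** X \<in> M" for s by (auto simp: closure_gaussian_rationals)
  \<comment> \<open>A diagonal matrix with square 0 is 0.\<close>
  have "\<exists>i j. i \<noteq> j \<and> X $ j $ i \<noteq> 0"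
  proof (rule ccontr)
    assume "\<not> ?thesis"
    then have off: "\<And>i j. i \<noteq> j \<Longrightarrow> X $ j $ i = 0" by auto
    have "X $ a $ a * X $ a $ a = 0" for a
    proof -
      have "(X ** X) $ a $ a = (\<Sum>k\<in>UNIV. X $ a $ k * X $ k $ a)" by (simp add: matrix_matrix_mult_def)
      also have "\<dots> = (\<Sum>k\<in>UNIV. if k = a then X $ a $ a * X $ a $ a else 0)"
        using off by (intro sum.cong) auto
      finally show ?thesis by (simp add: sq)
    qed
    then have "X = 0" using off by (simp add: vec_eq_iff) metis
    then show False using nz by simp
  qed
  then obtain i0 j0 where i0: "i0 \<noteq> j0" "X $ j0 $ i0 \<noteq> 0" by auto
  define P where "P i j \<longleftrightarrow> i \<noteq> j \<and> (\<forall>c. transvection i j c \<in> M)" for i j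
  have P0: "P i0 j0" using limit[OF Xall i0] i0 by (auto simp: P_def)
  have swap: "P j i" if "P i j" for i j
  proof -
    let ?X = "\<chi> a b. if a = i \<and> b = j then 1 else 0"
    have "mat 1 + mat s ** ?X = transvection i j s" for s :: complex
      by (simp add: vec_eq_iff transvection_def mat_nth)
    then show ?thesis
      using limit[of ?X j i] that by (auto simp: P_def)
  qed
  have rot: "P j k" if "P i j" "k \<noteq> i" "k \<noteq> j" for i j k
  proof -
    \<comment> \<open>This is \<open>E\<^sub>i\<^sub>j + E\<^sub>k\<^sub>j\<close>, which arises
      from \<open>E\<^sub>i\<^sub>j\<close> on conjugating by \<open>1 + E\<^sub>k\<^sub>i\<close>.
      Its nonzero entry at \<open>(k, j)\<close> gives the transvections for
      \<open>(j, k)\<close>.\<close>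
    let ?X = "\<chi> a b. if b = j \<and> (a = i \<or> a = k) then 1 else 0"
    have "mat 1 + mat s ** ?X = transvection k i (of_nat 1) ** transvection i j s ** transvection k i (- of_nat 1)" for s :: complex
      unfolding vec_eq_iff conj_transvection_nth using that
      by (auto simp: P_def transvection_def mat_nth)
    then have "mat 1 + mat s ** ?X \<in> M" for s
      using conj[of "transvection i j s" k i 1] that by (auto simp: P_def)
    then show ?thesis
      using limit[of ?X j k] that by (auto simp: P_def)
  qed
  have from_j: "P j l" if "P i j" "l \<noteq> j" for i j l
    using swap[OF that(1)] rot[OF that(1), of l] that(2) by blast
  have "P i j"
  proof (cases "i = j0")
    case True
    then show ?thesis using from_j[OF P0, of j] ij by simp
  next
    case False
    then show ?thesis using from_j[OF from_j[OF P0 False], of j] ij by simp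
  qed
  then show ?thesis by (simp add: P_def)
qed

section \<open>Minimality\<close>

lemma carrier_SL_iff: "A \<in> carrier (SL F) \<longleftrightarrow> (\<forall>i j. A $ i $ j \<in> F) \<and> det A = 1"
  by (simp add: SL_def)

lemma mult_SL: "A \<otimes>\<^bsub>SL F\<^esub> B = A ** B"
  by (simp add: SL_def)

lemma one_SL: "\<one>\<^bsub>SL F\<^esub> = mat 1"
  by (simp add: SL_def)

lemma transvection_in_SL:
  assumes "i \<noteq> j" "c \<in> gaussian_rationals"
  shows "transvection i j c \<in> carrier (SL gaussian_rationals)"
  using assms by (auto simp: carrier_SL_iff det_transvection)
    (auto simp: transvection_def gaussian_rationals_closed)

lemma det_mat: "det (mat c :: 'a::comm_ring_1^'n^'n) = c ^ CARD('n)"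
  by (subst det_diagonal) (auto simp: mat_nth)

lemma mat_mult_mat: "mat a ** mat b = (mat (a * b) :: 'a::comm_ring_1^'n^'n)"
  by (simp add: vec_eq_iff mat_nth)

lemma norm_transvection_minus_1: "norm (transvection i j c - mat 1 :: complex^'n^'n) \<le> norm c"
proof -
  have "norm (transvection i j c - mat 1 :: complex^'n^'n)
      \<le> (\<Sum>a\<in>UNIV. \<Sum>b\<in>UNIV. norm ((transvection i j c - mat 1 :: complex^'n^'n) $ a $ b))"
    by (rule norm_matrix_le_sum)
  also have "\<dots> = (\<Sum>a\<in>UNIV. \<Sum>b\<in>UNIV. if b = j then (if a = i then norm c else 0) else 0)"
    by (intro sum.cong) (auto simp: transvection_def mat_nth)
  also have "\<dots> = norm c" by simp
  finally show ?thesis .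
qed

text \<open>The set \<open>M\<close> below plays the role of the kernel of the extension of \<open>p\<close> to the closure \<open>SL(n, \<complex>)\<close>
  with respect to the coarser topology \<open>S\<close>; no completion has to be formed.\<close>

locale coarser_quotient_SL =
  fixes Q :: "('q, 'r) monoid_scheme" and TQ S :: "'q topology" and p :: "complex^'n^'n \<Rightarrow> 'q"
  assumes Q: "group Q"
    and hom: "p \<in> hom (SL gaussian_rationals) Q"
    and quot: "quotient_map (SL_topology gaussian_rationals) TQ p"
    and TQ: "topspace TQ = carrier Q"
    and S: "hausdorff_group Q S"
    and coarser: "coarser_topology S TQ"
begin

abbreviation "H \<equiv> carrier (SL gaussian_rationals :: (complex^'n^'n) monoid)"

definition nbhds :: "'q set set" where
  "nbhds = {U. openin S U \<and> \<one>\<^bsub>Q\<^esub> \<in> U}"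

definition pre :: "'q set \<Rightarrow> (complex^'n^'n) set" where
  "pre U = {x \<in> H. p x \<in> U}"

definition M :: "(complex^'n^'n) set" where
  "M = (\<Inter>U\<in>nbhds. closure (pre U))"

sublocale p: group_hom "SL gaussian_rationals" Q p
  by (intro group_hom.intro group_hom_axioms.intro SL_group(1) gaussian_rationals_closed Q hom)

section \<open>Neighbourhoods of the identity for \<open>S\<close>, their preimages in
  \<open>H\<close>, and the submonoid \<open>M\<close>\<close>

lemma topological_group_S: "topological_group Q S"
  using S by (simp add: hausdorff_group_def)

lemma topspace_S: "topspace S = carrier Q"
  using topological_group_S by (simp add: topological_group_def)

lemma topspace_nbhds: "topspace S \<in> nbhds"
  using openin_topspace[of S] by (simp add: nbhds_def topspace_S)

lemma inv_H: "h \<in> H \<Longrightarrow> inv\<^bsub>SL gaussian_rationals\<^esub> h = cramer_inverse h"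
  by (rule SL_group(2)[OF gaussian_rationals_closed])

lemma p_surj: "p ` H = carrier Q"
  using quotient_imp_surjective_map[OF quot] TQ by (simp add: SL_topology_def)

lemma p_mult: "A \<in> H \<Longrightarrow> B \<in> H \<Longrightarrow> p (A ** B) = p A \<otimes>\<^bsub>Q\<^esub> p B"
  using p.hom_mult[of A B] by (simp add: mult_SL)

lemma mult_H: "A \<in> H \<Longrightarrow> B \<in> H \<Longrightarrow> A ** B \<in> H"
  using p.G.m_closed[of A B] by (simp add: mult_SL)

lemma cramer_inverse_H: "A \<in> H \<Longrightarrow> cramer_inverse A \<in> H"
  using p.G.inv_closed[of A] by (simp add: inv_H)

lemma p_inv: "A \<in> H \<Longrightarrow> p (cramer_inverse A) = inv\<^bsub>Q\<^esub> (p A)"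
  using p.hom_inv[of A] by (simp add: inv_H)

lemma mat_1_H: "mat 1 \<in> H"
  using p.G.one_closed by (simp add: one_SL)

lemma p_one: "p (mat 1) = \<one>\<^bsub>Q\<^esub>"
  using p.hom_one by (simp add: one_SL)

lemma pre_open:
  assumes "openin TQ U"
  obtains W where "open W" "pre U = H \<inter> W"
proof -
  have "openin (SL_topology gaussian_rationals) {x \<in> topspace (SL_topology gaussian_rationals). p x \<in> U}"
    using quotient_imp_continuous_map[OF quot] assms by (rule openin_continuous_map_preimage)
  then show ?thesis
    using that by (auto simp: SL_topology_def pre_def openin_open)
qed

lemma nbhds_openin_TQ: "U \<in> nbhds \<Longrightarrow> openin TQ U"
  using coarser by (simp add: nbhds_def coarser_topology_def)

lemma nbhds_Inter:
  assumes "finite I" "I \<subseteq> nbhds" "U \<in> nbhds"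
  shows "U \<inter> \<Inter> I \<in> nbhds"
  using assms
proof (induction I rule: finite_induct)
  case (insert W I)
  then have "W \<in> nbhds" "U \<inter> \<Inter> I \<in> nbhds" by blast+
  then have "W \<inter> (U \<inter> \<Inter> I) \<in> nbhds" unfolding nbhds_def by (metis IntI mem_Collect_eq openin_Int)
  then show ?case by (simp add: Int_left_commute)
qed simp

lemma pre_mono: "U \<subseteq> W \<Longrightarrow> pre U \<subseteq> pre W"
  by (auto simp: pre_def)

text \<open>The combination of three factors serves twice: \<open>c = mat 1\<close> gives products,
  and \<open>c = a\<close> gives conjugates of a small element by another element of the same
  preimage.\<close>

lemma nbhds_mult:
  assumes "U \<in> nbhds"
  obtains W where "W \<in> nbhds" "\<And>a b c. a \<in> pre W \<Longrightarrow> b \<in> pre W \<Longrightarrow> c \<in> pre W \<Longrightarrow> a ** b ** cramer_inverse c \<in> pre U"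
proof -
  have "openin S U" "\<one>\<^bsub>Q\<^esub> \<in> U" using assms by (auto simp: nbhds_def)
  from topological_group_nbhd_conj[OF topological_group_S this]
  obtain V where V: "openin S V" "\<one>\<^bsub>Q\<^esub> \<in> V"
    "\<And>a b c. a \<in> V \<Longrightarrow> b \<in> V \<Longrightarrow> c \<in> V \<Longrightarrow> a \<otimes>\<^bsub>Q\<^esub> b \<otimes>\<^bsub>Q\<^esub> inv\<^bsub>Q\<^esub> c \<in> U" by metis
  show ?thesis
  proof (rule that)
    show "V \<in> nbhds" using V by (simp add: nbhds_def)
    show "a ** b ** cramer_inverse c \<in> pre U" if "a \<in> pre V" "b \<in> pre V" "c \<in> pre V" for a b c
      using that V(3) by (simp add: pre_def p_mult mult_H p_inv cramer_inverse_H)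
  qed
qed

lemma nbhds_conj:
  assumes "U \<in> nbhds" "h \<in> H"
  obtains W where "W \<in> nbhds" "\<And>a. a \<in> pre W \<Longrightarrow> h ** a ** cramer_inverse h \<in> pre U"
proof -
  let ?W = "{y \<in> topspace S. p h \<otimes>\<^bsub>Q\<^esub> y \<otimes>\<^bsub>Q\<^esub> inv\<^bsub>Q\<^esub> p h \<in> U}"
  have "continuous_map S S (\<lambda>y. p h \<otimes>\<^bsub>Q\<^esub> y \<otimes>\<^bsub>Q\<^esub> inv\<^bsub>Q\<^esub> p h)"
    using assms(2) topspace_S by (intro topological_group_continuous_mult[OF topological_group_S]) auto
  then have "openin S ?W"
    using assms(1) by (intro openin_continuous_map_preimage) (auto simp: nbhds_def)
  then have "?W \<in> nbhds" using assms topspace_S by (simp add: nbhds_def)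
  then show ?thesis
  proof (rule that)
    show "h ** a ** cramer_inverse h \<in> pre U" if "a \<in> pre ?W" for a
      using that assms(2) by (simp add: pre_def p_mult mult_H p_inv cramer_inverse_H)
  qed
qed

lemma mat_1_pre: "U \<in> nbhds \<Longrightarrow> mat 1 \<in> pre U"
  by (simp add: pre_def mat_1_H p_one nbhds_def)

text \<open>If \<open>p h\<close> is not the identity, disjoint \<open>S\<close>-open sets separate
  the two. As \<open>S\<close> is coarser than \<open>TQ\<close>, the preimage of the set around
  \<open>p h\<close> is relatively open in \<open>H\<close>, which keeps \<open>h\<close> out of the
  closure of the preimage of the other.\<close>

lemma M_Int_H: "M \<inter> H \<subseteq> kernel (SL gaussian_rationals) Q p"
proof
  fix h assume h: "h \<in> M \<inter> H"
  show "h \<in> kernel (SL gaussian_rationals) Q p"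
  proof (rule ccontr)
    assume "h \<notin> kernel (SL gaussian_rationals) Q p"
    then have "p h \<noteq> \<one>\<^bsub>Q\<^esub>" using h by (simp add: kernel_def)
    moreover have "Hausdorff_space S" using S by (simp add: hausdorff_group_def)
    ultimately obtain U W where UW: "openin S U" "openin S W" "\<one>\<^bsub>Q\<^esub> \<in> U" "p h \<in> W" "disjnt U W"
      unfolding Hausdorff_space_def using h topspace_S by (metis IntD2 p.hom_closed p.H.one_closed)
    obtain O' where O': "open O'" "pre W = H \<inter> O'"
      using pre_open[of W] UW(2) coarser by (auto simp: coarser_topology_def)
    have "O' \<inter> pre U = {}"
      using O'(2) UW(5) by (auto simp: pre_def disjnt_iff)
    then have "O' \<inter> closure (pre U) = {}" using O'(1) by (simp add: open_Int_closure_eq_empty)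
    moreover have "h \<in> O'" using O'(2) UW(4) h by (auto simp: pre_def)
    moreover have "h \<in> closure (pre U)" using h UW by (auto simp: M_def nbhds_def)
    ultimately show False by blast
  qed
qed

lemma closed_M: "closed M"
  unfolding M_def by (intro closed_INT) auto

lemma det_M: "A \<in> M \<Longrightarrow> det A = 1"
proof -
  assume "A \<in> M"
  have "A \<in> closure (pre (topspace S))" using \<open>A \<in> M\<close> topspace_nbhds by (auto simp: M_def)
  moreover have "closed ((det :: complex^'n^'n \<Rightarrow> complex) -` {1})"
    by (intro closed_vimage closed_singleton continuous_on_det continuous_on_id)
  moreover have "pre (topspace S) \<subseteq> det -` {1}" by (auto simp: pre_def carrier_SL_iff)
  ultimately show "det A = 1" using closure_minimal by blast
qed

lemma mult_M:
  assumes "A \<in> M" "B \<in> M"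
  shows "A ** B \<in> M"
  unfolding M_def
proof
  fix U assume "U \<in> nbhds"
  then obtain W where W: "W \<in> nbhds"
    "\<And>a b c. a \<in> pre W \<Longrightarrow> b \<in> pre W \<Longrightarrow> c \<in> pre W \<Longrightarrow> a ** b ** cramer_inverse c \<in> pre U"
    using nbhds_mult by blast
  have one: "cramer_inverse (mat 1 :: complex^'n^'n) = mat 1"
    using mult_cramer_inverse(1)[of "mat 1 :: complex^'n^'n"] by simp
  have "(\<lambda>z. fst z ** snd z) ` closure (pre W \<times> pre W) \<subseteq> closure (pre U)"
  proof (rule image_closure_subset)
    show "continuous_on (closure (pre W \<times> pre W)) (\<lambda>z. fst z ** snd z)"
      by (intro continuous_intros)
    show "(\<lambda>z. fst z ** snd z) ` (pre W \<times> pre W) \<subseteq> closure (pre U)"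
      using W(2)[OF _ _ mat_1_pre[OF W(1)]] closure_subset by (fastforce simp: one)
  qed auto
  moreover have "(A, B) \<in> closure (pre W \<times> pre W)"
    using assms W(1) by (auto simp: closure_Times M_def)
  ultimately show "A ** B \<in> closure (pre U)" by force
qed

lemma conj_M:
  assumes "A \<in> M" "h \<in> H"
  shows "h ** A ** cramer_inverse h \<in> M"
  unfolding M_def
proof
  fix U assume "U \<in> nbhds"
  then obtain W where W: "W \<in> nbhds" "\<And>a. a \<in> pre W \<Longrightarrow> h ** a ** cramer_inverse h \<in> pre U"
    using nbhds_conj assms(2) by blast
  have "(\<lambda>a. h ** a ** cramer_inverse h) ` closure (pre W) \<subseteq> closure (pre U)"
    using W(2) closure_subset by (intro image_closure_subset continuous_intros) auto
  then show "h ** A ** cramer_inverse h \<in> closure (pre U)"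
    using assms W(1) by (auto simp: M_def)
qed

lemma conj_transvection_M:
  assumes "A \<in> M" "i \<noteq> j"
  shows "transvection i j (of_nat k) ** A ** transvection i j (- of_nat k) \<in> M"
proof -
  let ?T = "transvection i j (of_nat k) :: complex^'n^'n" and ?T' = "transvection i j (- of_nat k) :: complex^'n^'n"
  have T: "?T \<in> H"
    using assms(2) by (intro transvection_in_SL) (auto simp: gaussian_rationals_iff)
  have "?T' ** ?T = mat 1"
    using assms(2) by (simp add: transvection_add)
  then have "cramer_inverse ?T = ?T'"
    using mult_cramer_inverse(1)[OF det_transvection[OF assms(2)], of "of_nat k"]
    by (metis matrix_mul_assoc matrix_mul_lid matrix_mul_rid)
  then show ?thesis using conj_M[OF assms(1) T] by simp
qed

text \<open>For each neighbourhood, a large conjugate of a small transvection yields some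
  \<open>X\<close> of controlled size with square 0 such that \<open>1 + s X\<close> lies in the
  closure of the preimage for all small Gaussian \<open>s\<close>. Compactness provides one
  \<open>X\<close> for all neighbourhoods, and then \<open>M\<close> contains all transvections,
  hence \<open>H\<close>.\<close>

lemma unbounded_imp_trivial:
  assumes unb: "\<And>U. U \<in> nbhds \<Longrightarrow> \<not> bounded (pre U)"
  shows "carrier Q = {\<one>\<^bsub>Q\<^esub>}"
proof -
  \<comment> \<open>A compact shell: the inner ball is removed so that the common \<open>X\<close>
    is nonzero.\<close>
  define K :: "(complex^'n^'n) set" where "K = cball 0 1 - ball 0 (1/2)"
  define C where "C U = {X. X ** X = 0 \<and> (\<forall>s\<in>gaussian_rationals. norm s \<le> 1 \<longrightarrow> mat 1 + mat s ** X \<in> closure (pre U))}" for U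
  have "K \<inter> (\<Inter>U\<in>nbhds. C U) \<noteq> {}"
  proof (rule compact_imp_fip_image)
    show "compact K" unfolding K_def by (intro compact_diff) auto
    show "closed (C U)" for U
    proof -
      have "C U = (\<lambda>X. X ** X) -` {0} \<inter> (\<Inter>s\<in>{s \<in> gaussian_rationals. norm s \<le> 1}. (\<lambda>X. mat 1 + mat s ** X) -` closure (pre U))"
        by (auto simp: C_def)
      also have "closed \<dots>"
        by (intro closed_Int closed_INT ballI closed_vimage continuous_intros closed_singleton closed_closure)
      finally show ?thesis .
    qed
    fix I assume I: "finite I" "I \<subseteq> nbhds"
    define U where "U = topspace S \<inter> \<Inter> I"
    have U: "U \<in> nbhds" unfolding U_def using I topspace_nbhds by (intro nbhds_Inter)
    obtain W where W: "W \<in> nbhds"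
      "\<And>a b c. a \<in> pre W \<Longrightarrow> b \<in> pre W \<Longrightarrow> c \<in> pre W \<Longrightarrow> a ** b ** cramer_inverse c \<in> pre U"
      using nbhds_mult[OF U] by blast
    obtain O' where O': "open O'" "pre W = H \<inter> O'"
      using pre_open[OF nbhds_openin_TQ[OF W(1)]] .
    then have "mat 1 \<in> O'" using mat_1_pre[OF W(1)] by auto
    then obtain d where d: "d > 0" "\<And>A. dist A (mat 1) < d \<Longrightarrow> A \<in> O'"
      using O'(1) unfolding open_dist by blast
    have "\<And>g. g \<in> pre W \<Longrightarrow> det g = 1" by (simp add: pre_def carrier_SL_iff)
    from unbounded_imp_large_conjugate[OF this unb[OF W(1)], of "max 1 (1 / d)"]
    obtain g i j a b where g: "g \<in> pre W" "i \<noteq> j"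
      and big: "max 1 (1 / d) < norm (g $ a $ i) * norm (cramer_inverse g $ j $ b)" by blast
    define h where "h = cramer_inverse g"
    have gh: "g ** h = mat 1" "h ** g = mat 1"
      using g(1) mult_cramer_inverse[of g] by (auto simp: h_def pre_def carrier_SL_iff)
    define Y where "Y = (\<chi> a b. g $ a $ i * h $ j $ b)"
    have YY: "Y ** Y = 0" unfolding Y_def by (rule conj_unit_square_zero[OF gh(2) g(2)])
    have "norm (Y $ a $ b) \<le> norm Y" by (rule norm_matrix_nth_le)
    then have nY: "norm Y > 1" "norm Y > 1 / d"
      using big by (auto simp: Y_def h_def norm_mult)
    have Ypos: "norm Y > 0" using nY(1) by linarith
    then have "1 / (2 * norm Y) < 1 / norm Y" by (intro divide_strict_left_mono) auto
    \<comment> \<open>Rationality of \<open>t\<close> keeps \<open>s * t\<close> Gaussian. The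
      bounds place \<open>t Y\<close> in the shell, and \<open>t < 1 / norm Y < d\<close> makes the
      transvection with parameter \<open>s * t\<close> close enough to the identity to lie in
      \<open>pre W\<close>.\<close>
    then obtain t where t: "t \<in> \<rat>" "1 / (2 * norm Y) < t" "t < 1 / norm Y"
      using Rats_dense_in_real by blast
    have "1 / (2 * norm Y) > 0" using Ypos by (intro divide_pos_pos) auto
    then have tpos: "t > 0" using t(2) by linarith
    have tg: "complex_of_real t \<in> gaussian_rationals" using t(1) by (simp add: gaussian_rationals_iff)
    define X where "X = mat (complex_of_real t) ** Y"
    have "X = t *\<^sub>R Y" by (simp add: X_def vec_eq_iff) (simp add: scaleR_conv_of_real)
    then have "norm X = t * norm Y" using tpos by simp
    then have "X \<in> K" using t Ypos by (simp add: K_def field_simps)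
    moreover have "X \<in> C U"
      unfolding C_def
    proof (intro CollectI conjI ballI impI)
      show "X ** X = 0" by (simp add: X_def mat_mult_mat_mult YY vec_eq_iff)
      fix s assume s: "s \<in> gaussian_rationals" "norm s \<le> 1"
      let ?T = "transvection i j (s * complex_of_real t) :: complex^'n^'n"
      have "norm (s * complex_of_real t) \<le> 1 * t" unfolding norm_mult using s(2) tpos by (intro mult_mono) auto
      also have "\<dots> < 1 / norm Y" using t by simp
      also have "\<dots> < d" using nY(2) Ypos d(1) by (simp add: field_simps)
      finally have "?T \<in> O'" using norm_transvection_minus_1[of i j "s * complex_of_real t"] by (intro d(2)) (simp add: dist_norm)
      moreover have "?T \<in> H" using g(2) s(1) tg by (intro transvection_in_SL gaussian_rationals_closed)
      ultimately have "?T \<in> pre W" using O'(2) by simp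
      then have "g ** ?T ** h \<in> pre U" using W(2) g(1) by (simp add: h_def)
      also have "g ** ?T ** h = mat 1 + mat s ** X"
        unfolding conj_transvection_by_inverse[OF gh(1)] Y_def[symmetric] X_def by (simp add: vec_eq_iff)
      finally show "mat 1 + mat s ** X \<in> closure (pre U)" using closure_subset by blast
    qed
    moreover have "C U \<subseteq> C U'" if "U' \<in> I" for U'
    proof -
      have "closure (pre U) \<subseteq> closure (pre U')"
        using that by (intro closure_mono pre_mono) (auto simp: U_def)
      then show ?thesis by (auto simp: C_def)
    qed
    ultimately show "K \<inter> (\<Inter>U\<in>I. C U) \<noteq> {}" by blast
  qed
  then obtain X where X: "X \<in> K" "\<And>U. U \<in> nbhds \<Longrightarrow> X \<in> C U" by blast
  have XX: "X ** X = 0" using X(2)[OF topspace_nbhds] by (auto simp: C_def)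
  have X0: "X \<noteq> 0" using X(1) by (auto simp: K_def)
  have one: "mat 1 \<in> M" using mat_1_pre closure_subset by (fastforce simp: M_def)
  have "transvection i j c \<in> M" if "i \<noteq> j" for i j c
    using X(2) by (intro all_transvections[OF closed_M mult_M one conj_transvection_M XX X0 _ that])
      (auto simp: C_def M_def)
  then have "H \<subseteq> M"
    using transvections_generate_SL[of M, OF one mult_M] by (auto simp: carrier_SL_iff)
  then have "p x = \<one>\<^bsub>Q\<^esub>" if "x \<in> H" for x
    using M_Int_H that by (auto simp: kernel_def)
  then have "p ` H \<subseteq> {\<one>\<^bsub>Q\<^esub>}" by blast
  then show ?thesis using p_surj p.H.one_closed by blast
qed

text \<open>A bounded \<open>M\<close> consists of scalars, and by the determinant these are roots
  of unity. The hypothesis \<open>roots\<close>, applied to the set of these scalars, places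
  \<open>M\<close> in \<open>H\<close>, hence in the kernel of \<open>p\<close>.\<close>

lemma bounded_imp_finer:
  assumes U0: "U0 \<in> nbhds" "bounded (pre U0)"
    and roots: "\<And>Z. (\<And>a b. a \<in> Z \<Longrightarrow> b \<in> Z \<Longrightarrow> a * b \<in> Z) \<Longrightarrow> (\<And>c. c \<in> Z \<Longrightarrow> c ^ CARD('n) = 1) \<Longrightarrow>
      (\<And>c. c \<in> Z \<Longrightarrow> c \<in> gaussian_rationals \<Longrightarrow> p (mat c) = \<one>\<^bsub>Q\<^esub>) \<Longrightarrow> Z \<subseteq> gaussian_rationals"
    and W: "openin TQ W" "\<one>\<^bsub>Q\<^esub> \<in> W"
  shows "\<exists>U\<in>nbhds. U \<subseteq> W"
proof -
  have "bounded M"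
    by (rule bounded_subset[OF bounded_closure[OF U0(2)]]) (use U0(1) in \<open>auto simp: M_def\<close>)
  then have scalar: "\<exists>c. A = mat c" if "A \<in> M" for A
    using bounded_normalized_imp_scalar[of M A, OF _ conj_transvection_M that] by metis
  have "{c. mat c \<in> M} \<subseteq> gaussian_rationals"
  proof (rule roots)
    show "a * b \<in> {c. mat c \<in> M}" if "a \<in> {c. mat c \<in> M}" "b \<in> {c. mat c \<in> M}" for a b
      using mult_M[of "mat a" "mat b"] that by (simp add: mat_mult_mat)
    show pow: "c ^ CARD('n) = 1" if "c \<in> {c. mat c \<in> M}" for c
      using det_M[of "mat c"] that by (simp add: det_mat)
    show "p (mat c) = \<one>\<^bsub>Q\<^esub>" if "c \<in> {c. mat c \<in> M}" "c \<in> gaussian_rationals" for c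
    proof -
      have "mat c \<in> H" using that pow[OF that(1)]
        by (simp add: carrier_SL_iff det_mat mat_nth gaussian_rationals_closed)
      then show ?thesis using that M_Int_H by (auto simp: kernel_def)
    qed
  qed
  then have "M \<subseteq> H"
    using scalar det_M by (auto simp: carrier_SL_iff mat_nth gaussian_rationals_closed) (metis mat_nth gaussian_rationals_closed(1) mem_Collect_eq subsetD)
  then have MN: "M \<subseteq> kernel (SL gaussian_rationals) Q p" using M_Int_H by blast
  obtain O' where O': "open O'" "pre W = H \<inter> O'" using pre_open[OF W(1)] .
  have MO: "M \<subseteq> O'"
  proof
    fix x assume "x \<in> M"
    then have "x \<in> pre W" using MN W(2) by (auto simp: kernel_def pre_def)
    then show "x \<in> O'" using O'(2) by simp
  qed
  \<comment> \<open>Otherwise the closures of the preimages have the finite intersection property on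
    the compact set \<open>closure (pre U0) - O'\<close>, and a point common to them all would be a
    point of \<open>M\<close> outside \<open>O'\<close>.\<close>
  have "\<exists>U\<in>nbhds. pre U \<subseteq> O'"
  proof (rule ccontr)
    assume neg: "\<not> ?thesis"
    have "(closure (pre U0) - O') \<inter> (\<Inter>U\<in>nbhds. closure (pre U)) \<noteq> {}"
    proof (rule compact_imp_fip_image)
      show "compact (closure (pre U0) - O')"
        using U0(2) O'(1) by (intro compact_diff) (simp_all add: compact_closure)
      show "closed (closure (pre U))" for U by simp
      fix I assume I: "finite I" "I \<subseteq> nbhds"
      then have "U0 \<inter> \<Inter> I \<in> nbhds" using nbhds_Inter U0(1) by blast
      then obtain x where x: "x \<in> pre (U0 \<inter> \<Inter> I)" "x \<notin> O'" using neg by blast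
      then have "x \<in> pre U0" "\<And>U. U \<in> I \<Longrightarrow> x \<in> pre U" by (auto simp: pre_def)
      then show "(closure (pre U0) - O') \<inter> (\<Inter>U\<in>I. closure (pre U)) \<noteq> {}"
        using x(2) closure_subset by blast
    qed
    then show False using MO by (auto simp: M_def)
  qed
  then obtain U where U: "U \<in> nbhds" "pre U \<subseteq> O'" by blast
  have "U \<subseteq> W"
  proof
    fix y assume y: "y \<in> U"
    then have "y \<in> carrier Q" using U(1) openin_subset topspace_S by (auto simp: nbhds_def)
    then obtain x where x: "x \<in> H" "y = p x" using p_surj by auto
    then have "x \<in> pre W" using y U(2) O'(2) by (auto simp: pre_def)
    then show "y \<in> W" using x by (simp add: pre_def)
  qed
  then show ?thesis using U(1) by blast
qed

end

text \<open>Either all preimages of neighbourhoods are unbounded and \<open>Q\<close> is trivial, or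
  one is bounded and \<open>S\<close> is as fine as \<open>TQ\<close> at the identity. All
  arithmetic sits in \<open>roots\<close>, where \<open>Z\<close> stands for the scalars in
  \<open>M\<close>; closure under multiplication is what the case of large powers of 2
  exploits.\<close>

lemma minimal_group_quotient_SL:
  fixes p :: "complex^'n^'n \<Rightarrow> 'q"
  assumes haus: "hausdorff_group Q TQ"
    and hom: "p \<in> hom (SL gaussian_rationals) Q"
    and quot: "quotient_map (SL_topology gaussian_rationals) TQ p"
    and roots: "\<And>Z. (\<And>a b. a \<in> Z \<Longrightarrow> b \<in> Z \<Longrightarrow> a * b \<in> Z) \<Longrightarrow> (\<And>c. c \<in> Z \<Longrightarrow> c ^ CARD('n) = 1) \<Longrightarrow>
      (\<And>c. c \<in> Z \<Longrightarrow> c \<in> gaussian_rationals \<Longrightarrow> p (mat c) = \<one>\<^bsub>Q\<^esub>) \<Longrightarrow> Z \<subseteq> gaussian_rationals"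
  shows "minimal_group Q TQ"
proof -
  have tg: "topological_group Q TQ" using haus by (simp add: hausdorff_group_def)
  have "S = TQ" if S: "hausdorff_group Q S" "coarser_topology S TQ" for S
  proof -
    interpret coarser_quotient_SL Q TQ S p
      by (rule coarser_quotient_SL.intro[OF _ hom quot _ S]) (use tg in \<open>auto simp: topological_group_def\<close>)
    have "\<exists>U\<in>nbhds. U \<subseteq> W" if W: "openin TQ W" "\<one>\<^bsub>Q\<^esub> \<in> W" for W
    proof (cases "\<exists>U\<in>nbhds. bounded (pre U)")
      case True
      then obtain U where "U \<in> nbhds" "bounded (pre U)" by blast
      then show ?thesis by (rule bounded_imp_finer[OF _ _ roots W])
    next
      case False
      then have "carrier Q = {\<one>\<^bsub>Q\<^esub>}" using unbounded_imp_trivial by blast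
      then show ?thesis using W topspace_S topspace_nbhds by (intro bexI[of _ "topspace S"]) auto
    qed
    then have "\<exists>V. openin S V \<and> \<one>\<^bsub>Q\<^esub> \<in> V \<and> V \<subseteq> U" if "openin TQ U" "\<one>\<^bsub>Q\<^esub> \<in> U" for U
      using that unfolding nbhds_def by blast
    then have "openin S U" if "openin TQ U" for U
      by (rule openin_topological_group_transfer[OF topological_group_S tg _ that])
    then show ?thesis
      using coarser by (auto simp: topology_eq coarser_topology_def)
  qed
  then show ?thesis using haus by (auto simp: minimal_group_def)
qed

section \<open>Failure of minimality\<close>

lemma hausdorff_group_SL_complex:
  "hausdorff_group (SL UNIV :: (complex^'n^'n) monoid) (SL_topology UNIV)"
proof -
  let ?G = "SL UNIV :: (complex^'n^'n) monoid"
  have g: "group ?G" and inv: "\<And>A. A \<in> carrier ?G \<Longrightarrow> inv\<^bsub>?G\<^esub> A = cramer_inverse A"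
    using SL_group[where F = "UNIV :: complex set" and 'n = 'n] by auto
  interpret group ?G by (rule g)
  have "continuous_on (carrier ?G \<times> carrier ?G) (\<lambda>p. fst p ** snd p)"
    by (intro continuous_intros)
  moreover have "fst p ** snd p \<in> carrier ?G" if "p \<in> carrier ?G \<times> carrier ?G" for p
    using that m_closed[of "fst p" "snd p"] by (auto simp: mult_SL)
  ultimately have 1: "continuous_map (prod_topology (top_of_set (carrier ?G)) (top_of_set (carrier ?G)))
      (top_of_set (carrier ?G)) (\<lambda>(x, y). x \<otimes>\<^bsub>?G\<^esub> y)"
    by (auto simp: mult_SL case_prod_unfold)
  have "continuous_on (carrier ?G) (cramer_inverse :: complex^'n^'n \<Rightarrow> complex^'n^'n)"
    unfolding cramer_inverse_def
    apply (intro continuous_intros)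
    subgoal for k l i j by (cases "j = k") (auto intro!: continuous_intros)
    done
  then have "continuous_on (carrier ?G) (\<lambda>x. inv\<^bsub>?G\<^esub> x)"
    by (rule continuous_on_eq) (simp add: inv)
  then have "continuous_map (top_of_set (carrier ?G)) (top_of_set (carrier ?G)) (\<lambda>x. inv\<^bsub>?G\<^esub> x)"
    by auto
  then show ?thesis
    using 1 g
    by (auto simp: hausdorff_group_def topological_group_def SL_topology_def
        intro: Hausdorff_space_subtopology)
qed

lemma mat_commute: "mat c ** A = A ** (mat c :: 'a::comm_ring_1^'n^'n)"
  by (simp add: vec_eq_iff mult.commute)

lemma mat_eq_mat_iff: "(mat a :: 'a::comm_ring_1^'n^'n) = mat b \<longleftrightarrow> a = b"
  by (auto simp: vec_eq_iff mat_nth)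

text \<open>When \<open>z\<close> is an n-th root of unity, natural exponents already produce a
  cyclic group. With \<open>F = UNIV\<close> this is the subgroup generated by \<open>z\<close> in
  SL(n, \<complex>); with the Gaussian rationals it is the intersection of that subgroup with
  \<open>H\<close>.\<close>

definition scalars :: "complex set \<Rightarrow> complex \<Rightarrow> (complex^'n^'n) set" where
  "scalars F z = {A \<in> carrier (SL F). \<exists>k. A = mat (z ^ k)}"

lemma scalars_normal:
  assumes G: "group (SL F :: (complex^'n^'n) monoid)" and z: "z ^ CARD('n) = 1"
  shows "scalars F z \<lhd> (SL F :: (complex^'n^'n) monoid)"
proof -
  let ?G = "SL F :: (complex^'n^'n) monoid"
  interpret group ?G by (rule G)
  have inv: "inv\<^bsub>?G\<^esub> A = mat (z ^ (k * (CARD('n) - 1)))" if A: "A \<in> carrier ?G" "A = mat (z ^ k)" for A k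
  proof -
    have "z ^ (k * (CARD('n) - 1)) * z ^ k = z ^ (k * CARD('n))"
      by (simp add: power_add[symmetric] diff_mult_distrib2)
    then have "mat (z ^ (k * (CARD('n) - 1))) ** A = mat 1"
      using z by (simp add: A(2) mat_mult_mat mult.commute[of k] power_mult)
    moreover have "A ** inv\<^bsub>?G\<^esub> A = mat 1" using r_inv[OF A(1)] by (simp add: mult_SL one_SL)
    ultimately show ?thesis by (metis matrix_mul_assoc matrix_mul_lid matrix_mul_rid)
  qed
  have "subgroup (scalars F z) ?G"
  proof (rule subgroupI)
    have "(mat 1 :: complex^'n^'n) \<in> scalars F z"
      unfolding scalars_def using one_closed
      by (intro CollectI conjI exI[of _ 0]) (simp_all add: one_SL)
    then show "(scalars F z :: (complex^'n^'n) set) \<noteq> {}" by blast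
    show "inv\<^bsub>?G\<^esub> A \<in> scalars F z" if "A \<in> scalars F z" for A
    proof -
      obtain k where k: "A \<in> carrier ?G" "A = mat (z ^ k)" using \<open>A \<in> scalars F z\<close> by (auto simp: scalars_def)
      show ?thesis using inv[OF k] inv_closed[OF k(1)] by (auto simp: scalars_def)
    qed
    show "A \<otimes>\<^bsub>?G\<^esub> B \<in> scalars F z" if AB: "A \<in> scalars F z" "B \<in> scalars F z" for A B
    proof -
      obtain k l where k: "A \<in> carrier ?G" "A = mat (z ^ k)" and l: "B \<in> carrier ?G" "B = mat (z ^ l)"
        using AB by (auto simp: scalars_def)
      have "A \<otimes>\<^bsub>?G\<^esub> B = mat (z ^ (k + l))"
        by (simp add: k(2) l(2) mult_SL mat_mult_mat power_add)
      then show ?thesis using m_closed[OF k(1) l(1)] by (auto simp: scalars_def)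
    qed
  qed (auto simp: scalars_def)
  moreover have "x \<otimes>\<^bsub>?G\<^esub> h \<otimes>\<^bsub>?G\<^esub> inv\<^bsub>?G\<^esub> x \<in> scalars F z" if x: "x \<in> carrier ?G" "h \<in> scalars F z" for x h
  proof -
    obtain k where k: "h \<in> carrier ?G" "h = mat (z ^ k)" using x(2) by (auto simp: scalars_def)
    have "x \<otimes>\<^bsub>?G\<^esub> h = h \<otimes>\<^bsub>?G\<^esub> x" by (simp add: k(2) mult_SL mat_commute)
    then have "x \<otimes>\<^bsub>?G\<^esub> h \<otimes>\<^bsub>?G\<^esub> inv\<^bsub>?G\<^esub> x = h" using x(1) k(1) by (simp add: m_assoc)
    then show ?thesis using x(2) by simp
  qed
  ultimately show ?thesis by (simp add: normal_inv_iff)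
qed

lemma closedin_scalars:
  assumes "(z :: complex) ^ CARD('n) = 1"
  shows "closedin (SL_topology F) (scalars F z :: (complex^'n^'n) set)"
proof -
  have "z ^ k = z ^ (k mod CARD('n))" for k
    by (metis assms div_mult_mod_eq mult.commute mult_1 power_add power_mult power_one)
  then have "scalars F z \<subseteq> (\<lambda>k. mat (z ^ k) :: complex^'n^'n) ` {..<CARD('n)}"
    unfolding scalars_def by (force intro!: image_eqI[of _ _ "_ mod CARD('n)"])
  then have "finite (scalars F z :: (complex^'n^'n) set)" by (rule finite_subset) simp
  then have "closed (scalars F z :: (complex^'n^'n) set)" by (rule finite_imp_closed)
  then show ?thesis
    unfolding SL_topology_def by (rule closed_subset[rotated]) (auto simp: scalars_def)
qed

text \<open>The diagonal matrices \<open>diag (a, \<dots>, a, a\<^bsup>1-n\<^esup>)\<close> with \<open>a\<close> in \<open>\<rat>(\<i>)\<close> close to \<open>z\<close> approximate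
  the scalar matrix \<open>z\<close>.\<close>

lemma approximate_scalar:
  fixes W :: "(complex^'n^'n) set"
  assumes W: "open W" "mat z \<in> W" and z: "z ^ CARD('n) = 1"
  obtains A where "A \<in> W" "A \<in> carrier (SL gaussian_rationals)"
proof -
  obtain k :: 'n where True by simp
  define n where "n = CARD('n)"
  define D :: "complex \<Rightarrow> complex^'n^'n" where
    "D a = (\<chi> i j. if i = j then (if i = k then inverse a ^ (n - 1) else a) else 0)" for a
  have z0: "z \<noteq> 0" using z by (auto simp: power_0_left)
  have n: "n = Suc (n - 1)" by (simp add: n_def)
  have "inverse z ^ (n - 1) = z"
  proof -
    have "z * z ^ (n - 1) = 1" using z n by (metis n_def power_Suc)
    then show ?thesis by (metis inverse_unique mult.commute power_inverse)
  qed
  then have Dz: "D z = mat z" by (simp add: D_def vec_eq_iff mat_nth)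
  have "continuous_on (- {0}) D"
    unfolding D_def
    apply (intro continuous_intros)
    subgoal for i j by (cases "i = j"; cases "i = k") (auto intro!: continuous_intros)
    done
  then have "open (- {0} \<inter> D -` W)"
    using W(1) by (intro continuous_open_preimage) auto
  moreover have "z \<in> - {0} \<inter> D -` W" using W(2) z0 Dz by simp
  moreover have "z \<in> closure gaussian_rationals" by (simp add: closure_gaussian_rationals)
  ultimately obtain a where a: "a \<in> gaussian_rationals" "a \<noteq> 0" "D a \<in> W"
    by (auto simp: closure_iff_nhds_not_empty)
  have "det (D a) = (\<Prod>i\<in>UNIV. D a $ i $ i)"
    by (rule det_diagonal) (simp add: D_def)
  also have "\<dots> = inverse a ^ (n - 1) * (\<Prod>i\<in>UNIV - {k}. a)"
    by (subst prod.remove[of _ k]) (auto simp: D_def)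
  also have "\<dots> = 1"
    using a(2) by (simp add: n_def power_inverse)
  finally have "D a \<in> carrier (SL gaussian_rationals)"
    using a(1) by (auto simp: carrier_SL_iff D_def gaussian_rationals_closed gaussian_rationals_power gaussian_rationals_inverse)
  then show ?thesis using a(3) that by blast
qed

text \<open>The competing topology comes from embedding \<open>Q\<close> into \<open>R\<close>, the
  quotient of SL(n, \<complex>) by the scalars generated by \<open>z\<close>. It is coarser than
  \<open>TQ\<close>, and strictly so: elements of \<open>H\<close> near \<open>mat z\<close> are
  close to the identity in \<open>R\<close> but not in \<open>Q\<close>.\<close>

lemma not_minimal_group_quotient_SL:
  fixes p :: "complex^'n^'n \<Rightarrow> 'q"
  assumes haus: "hausdorff_group Q TQ"
    and hom: "p \<in> hom (SL gaussian_rationals) Q"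
    and quot: "quotient_map (SL_topology gaussian_rationals) TQ p"
    and ker: "kernel (SL gaussian_rationals) Q p = scalars gaussian_rationals z"
    and z: "z ^ CARD('n) = 1" "z ^ 4 \<noteq> 1"
  shows "\<not> minimal_group Q TQ"
proof
  assume min: "minimal_group Q TQ"
  let ?H = "SL gaussian_rationals :: (complex^'n^'n) monoid" and ?G = "SL UNIV :: (complex^'n^'n) monoid"
  let ?Z = "scalars UNIV z :: (complex^'n^'n) set"
  define R where "R = ?G Mod ?Z"
  define r where "r = (\<lambda>x. ?Z #>\<^bsub>?G\<^esub> x)"
  define TR where "TR = quotient_group_topology ?G (SL_topology UNIV) ?Z"
  have G: "group ?G" and tgG: "topological_group ?G (SL_topology UNIV)"
    using hausdorff_group_SL_complex by (auto simp: hausdorff_group_def topological_group_def)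
  have H: "group ?H" using SL_group(1)[OF gaussian_rationals_closed] .
  have Q: "group Q" and TQ: "topspace TQ = carrier Q"
    using haus by (auto simp: hausdorff_group_def topological_group_def)
  have Z: "?Z \<lhd> ?G" by (rule scalars_normal[OF G z(1)])
  have hausR: "hausdorff_group R TR"
    unfolding TR_def R_def by (rule hausdorff_group_FactGroup[OF tgG Z closedin_scalars[OF z(1)]])
  interpret p: group_hom ?H Q p
    by (intro group_hom.intro group_hom_axioms.intro H Q hom)
  interpret r: group_hom ?G "R" r
    unfolding r_def R_def using Z G
    by (intro group_hom.intro group_hom_axioms.intro normal.r_coset_hom_Mod normal.factorgroup_is_group)
  have kerR: "kernel ?G R r = ?Z" unfolding r_def R_def by (rule kernel_r_coset[OF Z])
  have HG: "carrier ?H \<subseteq> carrier ?G" by (auto simp: carrier_SL_iff)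
  have invH: "inv\<^bsub>?H\<^esub> A = inv\<^bsub>?G\<^esub> A" if "A \<in> carrier ?H" for A
    using SL_group(2)[OF gaussian_rationals_closed that] SL_group(2)[of UNIV A] that HG by auto
  \<comment> \<open>On \<open>H\<close> both maps have the same fibres, because the kernel of
    \<open>r\<close> meets \<open>H\<close> in the kernel of \<open>p\<close>. So \<open>r\<close>
    induces a well-defined injective map \<open>j\<close> on \<open>Q\<close>.\<close>
  have iff: "p A = p B \<longleftrightarrow> r A = r B" if A: "A \<in> carrier ?H" and B: "B \<in> carrier ?H" for A B
  proof -
    let ?C = "A \<otimes>\<^bsub>?H\<^esub> inv\<^bsub>?H\<^esub> B"
    have C: "?C \<in> carrier ?H" using A B by simp
    have "p A = p B \<longleftrightarrow> p ?C = \<one>\<^bsub>Q\<^esub>"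
      using A B by (simp add: p.H.mult_inv_eq_one_iff)
    also have "\<dots> \<longleftrightarrow> ?C \<in> ?Z"
      using C ker HG by (auto simp: kernel_def scalars_def)
    also have "\<dots> \<longleftrightarrow> r ?C = \<one>\<^bsub>R\<^esub>"
      using C kerR HG by (auto simp: kernel_def)
    also have "?C = A \<otimes>\<^bsub>?G\<^esub> inv\<^bsub>?G\<^esub> B" using invH[OF B] by (simp add: mult_SL)
    also have "r (A \<otimes>\<^bsub>?G\<^esub> inv\<^bsub>?G\<^esub> B) = \<one>\<^bsub>R\<^esub> \<longleftrightarrow> r A = r B"
      using A B HG by (simp add: r.H.mult_inv_eq_one_iff subsetD)
    finally show ?thesis .
  qed
  have surj: "p ` carrier ?H = carrier Q"
    using quotient_imp_surjective_map[OF quot] TQ by (simp add: SL_topology_def)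
  define j where "j q = r (inv_into (carrier ?H) p q)" for q
  have jp: "j (p A) = r A" if "A \<in> carrier ?H" for A
    using that iff[of "inv_into (carrier ?H) p (p A)" A]
    by (simp add: j_def f_inv_into_f inv_into_into)
  have j: "j \<in> hom Q R"
  proof (rule homI)
    fix x assume "x \<in> carrier Q"
    then obtain A where "A \<in> carrier ?H" "x = p A" using surj by blast
    then show "j x \<in> carrier R" using HG by (simp add: jp subsetD)
  next
    fix x y assume "x \<in> carrier Q" "y \<in> carrier Q"
    then obtain A B where AB: "A \<in> carrier ?H" "B \<in> carrier ?H" "x = p A" "y = p B" using surj by blast
    have "x \<otimes>\<^bsub>Q\<^esub> y = p (A \<otimes>\<^bsub>?H\<^esub> B)" using AB by simp
    then have "j (x \<otimes>\<^bsub>Q\<^esub> y) = r (A \<otimes>\<^bsub>?G\<^esub> B)"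
      using AB by (simp only: jp p.G.m_closed) (simp add: mult_SL)
    also have "\<dots> = j x \<otimes>\<^bsub>R\<^esub> j y"
      using AB HG by (simp add: jp subsetD)
    finally show "j (x \<otimes>\<^bsub>Q\<^esub> y) = j x \<otimes>\<^bsub>R\<^esub> j y" .
  qed
  have inj: "inj_on j (carrier Q)"
  proof (rule inj_onI)
    fix x y assume xy: "x \<in> carrier Q" "y \<in> carrier Q" "j x = j y"
    from xy(1,2) obtain A B where AB: "A \<in> carrier ?H" "B \<in> carrier ?H" "x = p A" "y = p B"
      using surj by blast
    have "j (p A) = j (p B)" using xy(3) unfolding AB(3,4) .
    then have "r A = r B" unfolding jp[OF AB(1)] jp[OF AB(2)] .
    then show "x = y" unfolding AB(3,4) iff[OF AB(1,2)] .
  qed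
  define S where "S = pullback_topology (carrier Q) j TR"
  have S: "hausdorff_group Q S" unfolding S_def by (rule hausdorff_group_pullback[OF hausR Q j inj])
  have topG: "topspace (SL_topology UNIV) = carrier ?G" by (simp add: SL_topology_def)
  have preimage: "\<exists>W. open W \<and> {x \<in> carrier ?G. r x \<in> V} = carrier ?G \<inter> W" if V: "openin TR V" for V
  proof -
    have "continuous_map (SL_topology UNIV) TR r"
      unfolding TR_def r_def
      using quotient_imp_continuous_map[OF quotient_map_quotient_group_topology[OF topG]] .
    from openin_continuous_map_preimage[OF this V]
    show ?thesis by (auto simp: SL_topology_def openin_open)
  qed
  have "coarser_topology S TQ"
    unfolding coarser_topology_def
  proof (intro conjI allI impI)
    show "topspace S = topspace TQ"
      using S TQ by (simp add: hausdorff_group_def topological_group_def)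
    fix U assume "openin S U"
    then obtain V where V: "openin TR V" "U = j -` V \<inter> carrier Q"
      by (auto simp: S_def openin_pullback_topology)
    obtain W where W: "open W" "{x \<in> carrier ?G. r x \<in> V} = carrier ?G \<inter> W" using preimage[OF V(1)] by blast
    have "{x \<in> carrier ?H. p x \<in> U} = carrier ?H \<inter> {x \<in> carrier ?G. r x \<in> V}"
      using HG by (auto simp: V(2) jp)
    also have "\<dots> = carrier ?H \<inter> W" unfolding W(2) using HG by blast
    finally have "openin (SL_topology gaussian_rationals) {x \<in> topspace (SL_topology gaussian_rationals). p x \<in> U}"
      using W(1) by (auto simp: SL_topology_def openin_open)
    then show "openin TQ U"
      using quot V(2) TQ by (auto simp: quotient_map_def)
  qed
  then have STQ: "S = TQ" using min S by (auto simp: minimal_group_def)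
  obtain k :: 'n where True by simp
  \<comment> \<open>The fourth power makes \<open>f\<close> constant on the fibres of
    \<open>p\<close>: two elements of a fibre differ by a scalar in \<rat>(\<i>) that is a root of
    unity, so its fourth power is 1. Yet \<open>f\<close> separates \<open>mat 1\<close> from
    \<open>mat z\<close>, since \<open>z ^ 4\<close> is not 1.\<close>
  define f where "f A = norm ((A $ k $ k) ^ 4 - 1)" for A :: "complex^'n^'n"
  have fc: "continuous_on UNIV f" unfolding f_def by (intro continuous_intros)
  define e where "e = norm (z ^ 4 - 1) / 2"
  have e: "e > 0" "f (mat z) > e" using z(2) by (auto simp: e_def f_def mat_nth)
  define U0 where "U0 = carrier ?H \<inter> f -` {..<e}"
  have finv: "f A = f B" if A: "A \<in> carrier ?H" and B: "B \<in> carrier ?H" and AB: "p A = p B" for A B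
  proof -
    let ?C = "A \<otimes>\<^bsub>?H\<^esub> inv\<^bsub>?H\<^esub> B"
    have C: "?C \<in> carrier ?H" using A B by simp
    have "p ?C = \<one>\<^bsub>Q\<^esub>" using A B AB by simp
    then have "?C \<in> scalars gaussian_rationals z" using ker C by (auto simp: kernel_def)
    then obtain l where l: "?C = mat (z ^ l)" by (auto simp: scalars_def)
    then have "(mat (z ^ l) :: complex^'n^'n) \<in> carrier ?H" using C by simp
    then have "(mat (z ^ l) :: complex^'n^'n) $ k $ k \<in> gaussian_rationals" unfolding carrier_SL_iff by blast
    then have zl: "z ^ l \<in> gaussian_rationals" by (simp add: mat_nth)
    have "(z ^ l) ^ CARD('n) = 1" using z(1) by (metis mult.commute power_mult power_one)
    then have z4: "(z ^ l) ^ 4 = 1" using root_of_unity_gaussian_rationals[OF zl] by simp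
    have "A = ?C \<otimes>\<^bsub>?H\<^esub> B" using A B by (simp add: p.G.m_assoc)
    then have "A $ k $ k = z ^ l * B $ k $ k" unfolding l by (simp add: mult_SL)
    then show ?thesis using z4 by (simp add: f_def power_mult_distrib)
  qed
  have U0: "{x \<in> carrier ?H. p x \<in> p ` U0} = U0"
    using finv by (auto simp: U0_def)
  have quot_iff: "openin TQ U \<longleftrightarrow> openin (SL_topology gaussian_rationals) {x \<in> carrier ?H. p x \<in> U}"
    if "U \<subseteq> carrier Q" for U
    using quot that TQ by (simp add: quotient_map_def SL_topology_def)
  have "p ` U0 \<subseteq> carrier Q" unfolding surj[symmetric] U0_def by blast
  moreover have "openin (SL_topology gaussian_rationals) U0"
    unfolding U0_def SL_topology_def by (rule openin_open_Int) (rule open_vimage[OF open_lessThan fc])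
  ultimately have "openin TQ (p ` U0)" by (simp only: quot_iff U0)
  then obtain V where V: "openin TR V" "p ` U0 = j -` V \<inter> carrier Q"
    unfolding STQ[symmetric] S_def openin_pullback_topology by blast
  obtain W where W: "open W" "{x \<in> carrier ?G. r x \<in> V} = carrier ?G \<inter> W" using preimage[OF V(1)] by blast
  have one: "mat 1 \<in> carrier ?H" using p.G.one_closed by (simp add: one_SL)
  then have "mat 1 \<in> U0" using e(1) by (simp add: U0_def f_def mat_nth)
  then have "j (p (mat 1)) \<in> V" using V(2) by blast
  then have "r (mat 1) \<in> V" using one by (simp add: jp)
  \<comment> \<open>As \<open>r\<close> does not distinguish these two matrices, the open set
    \<open>W\<close> describing the preimage of \<open>V\<close> contains \<open>mat z\<close> as
    well. By density it then contains an element of \<open>H\<close> with \<open>f\<close> larger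
    than \<open>e\<close>, which contradicts the choice of \<open>U0\<close>.\<close>
  moreover have "r (mat z) = r (mat 1)"
  proof -
    have "mat z \<in> ?Z"
      using z(1) by (auto simp: scalars_def carrier_SL_iff det_mat intro!: exI[of _ 1])
    then have "r (mat z) = \<one>\<^bsub>R\<^esub>" using kerR by (auto simp: kernel_def)
    then show ?thesis using r.hom_one by (simp add: one_SL)
  qed
  moreover have "mat z \<in> carrier ?G" using z(1) by (simp add: carrier_SL_iff det_mat)
  ultimately have "mat z \<in> {x \<in> carrier ?G. r x \<in> V}" by simp
  then have "mat z \<in> W" unfolding W(2) by simp
  then have "mat z \<in> W \<inter> f -` {e<..}" using e(2) by simp
  moreover have "open (W \<inter> f -` {e<..})"
    by (rule open_Int[OF W(1) open_vimage[OF open_greaterThan fc]])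
  ultimately obtain A where A: "A \<in> W \<inter> f -` {e<..}" "A \<in> carrier ?H"
    using approximate_scalar[OF _ _ z(1)] by metis
  then have "A \<in> carrier ?G \<inter> W" using HG by blast
  then have "r A \<in> V" unfolding W(2)[symmetric] by simp
  then have "p A \<in> p ` U0" unfolding V(2) using A(2) by (simp add: jp)
  then have "A \<in> {x \<in> carrier ?H. p x \<in> p ` U0}" using A(2) by simp
  then have "A \<in> U0" unfolding U0 .
  then show False using A(1) by (simp add: U0_def)
qed

text \<open>This allows the criteria for quotients to be applied to the group itself, with trivial
  kernel.\<close>

lemma id_quotient_SL:
  "id \<in> hom (SL gaussian_rationals :: (complex^'n^'n) monoid) (SL gaussian_rationals)"
  "quotient_map (SL_topology gaussian_rationals) (SL_topology gaussian_rationals :: (complex^'n^'n) topology) id"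
  by (auto simp: hom_def quotient_map_def openin_subset)
    (metis (no_types, lifting) Collect_mem_eq Collect_cong inf.absorb2 inf_def openin_subset subsetD)+

lemma quotient_SL_Mod:
  fixes N :: "(complex^'n^'n) set"
  assumes N: "N \<lhd> SL gaussian_rationals" "closedin (SL_topology gaussian_rationals) N"
  shows "hausdorff_group (SL gaussian_rationals Mod N) (quotient_group_topology (SL gaussian_rationals) (SL_topology gaussian_rationals) N)"
    "(\<lambda>x. N #>\<^bsub>SL gaussian_rationals\<^esub> x) \<in> hom (SL gaussian_rationals) (SL gaussian_rationals Mod N)"
    "quotient_map (SL_topology gaussian_rationals) (quotient_group_topology (SL gaussian_rationals) (SL_topology gaussian_rationals) N)
      (\<lambda>x. N #>\<^bsub>SL gaussian_rationals\<^esub> x)"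
proof -
  have tg: "topological_group (SL gaussian_rationals :: (complex^'n^'n) monoid) (SL_topology gaussian_rationals)"
    using hausdorff_group_SL[where 'n = 'n] by (simp add: hausdorff_group_def)
  show "hausdorff_group (SL gaussian_rationals Mod N) (quotient_group_topology (SL gaussian_rationals) (SL_topology gaussian_rationals) N)"
    by (rule hausdorff_group_FactGroup[OF tg N])
  show "(\<lambda>x. N #>\<^bsub>SL gaussian_rationals\<^esub> x) \<in> hom (SL gaussian_rationals) (SL gaussian_rationals Mod N)"
    by (rule normal.r_coset_hom_Mod[OF N(1)])
  show "quotient_map (SL_topology gaussian_rationals) (quotient_group_topology (SL gaussian_rationals) (SL_topology gaussian_rationals) N)
      (\<lambda>x. N #>\<^bsub>SL gaussian_rationals\<^esub> x)"
    using tg by (intro quotient_map_quotient_group_topology) (simp add: topological_group_def)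
qed

theorem corollary5p3:
  shows
    "(CARD('n::finite) \<in> {1, 2, 4} \<longrightarrow>
       totally_minimal_group (SL gaussian_rationals :: (complex^'n^'n) monoid) (SL_topology gaussian_rationals))
     \<and>
     (\<forall>k::nat. k > 2 \<and> CARD('n) = 2 ^ k \<longrightarrow>
       minimal_group (SL gaussian_rationals :: (complex^'n^'n) monoid) (SL_topology gaussian_rationals) \<and>
       \<not> totally_minimal_group (SL gaussian_rationals :: (complex^'n^'n) monoid) (SL_topology gaussian_rationals))
     \<and>
     ((\<nexists>k::nat. CARD('n) = 2 ^ k) \<longrightarrow>
       \<not> minimal_group (SL gaussian_rationals :: (complex^'n^'n) monoid) (SL_topology gaussian_rationals))"
proof (intro conjI impI allI)
  let ?H = "SL gaussian_rationals :: (complex^'n^'n) monoid"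
  let ?T = "SL_topology gaussian_rationals :: (complex^'n^'n) topology"
  {
    assume n: "CARD('n) \<in> {1, 2, 4}"
    \<comment> \<open>The sizes 1, 2 and 4 are the divisors of 4, so every n-th root of unity is
      Gaussian and the arithmetic hypothesis holds for every quotient.\<close>
    have roots: "c \<in> gaussian_rationals" if "c ^ CARD('n) = 1" for c :: complex
    proof (rule power_4_eq_1_imp_gaussian)
      have "CARD('n) dvd 4" using n by auto
      then show "c ^ 4 = 1" using that by (metis dvdE power_mult power_one)
    qed
    show "totally_minimal_group ?H ?T"
      unfolding totally_minimal_group_def
    proof (intro conjI allI impI hausdorff_group_SL)
      fix N assume "N \<lhd> ?H \<and> closedin ?T N"
      then have N: "N \<lhd> ?H" "closedin ?T N" by auto
      show "minimal_group (?H Mod N) (quotient_group_topology ?H ?T N)"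
        by (rule minimal_group_quotient_SL[OF quotient_SL_Mod[OF N]]) (use roots in blast)
    qed
  }
  {
    fix k :: nat assume k: "k > 2 \<and> CARD('n) = 2 ^ k"
    show "minimal_group ?H ?T"
    proof (rule minimal_group_quotient_SL[OF hausdorff_group_SL id_quotient_SL])
      fix Z :: "complex set"
      assume mult: "\<And>a b. a \<in> Z \<Longrightarrow> b \<in> Z \<Longrightarrow> a * b \<in> Z"
        and pow: "\<And>c. c \<in> Z \<Longrightarrow> c ^ CARD('n) = 1"
        and ker: "\<And>c. c \<in> Z \<Longrightarrow> c \<in> gaussian_rationals \<Longrightarrow> id (mat c) = \<one>\<^bsub>?H\<^esub>"
      \<comment> \<open>For \<open>p = id\<close> a Gaussian scalar in \<open>Z\<close> must be 1.
        In particular -1 is not in \<open>Z\<close>, and a multiplicative set of roots of unity of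
        2-power order without -1 is trivial.\<close>
      have "c = 1" if "c \<in> Z" "c \<in> gaussian_rationals" for c
        using ker[OF that] by (simp add: one_SL mat_eq_mat_iff)
      then have "- 1 \<notin> Z" by (force simp: gaussian_rationals_iff)
      then have "c = 1" if "c \<in> Z" for c
        using trivial_roots_of_unity_2_power[OF mult _ that, of k] pow[OF that] k by simp
      then show "Z \<subseteq> gaussian_rationals" using gaussian_rationals_closed(2) by blast
    qed
    \<comment> \<open>A primitive eighth root of unity: 8 divides \<open>2 ^ k\<close> because
      \<open>k > 2\<close>, while \<open>z ^ 4 = - 1\<close>.\<close>
    define z where "z = cis (pi / 4)"
    have z4: "z ^ 4 = - 1" by (simp add: z_def Complex.DeMoivre)
    have "k = 3 + (k - 3)" using k by simp
    then have "(2::nat) ^ k = 2 ^ 3 * 2 ^ (k - 3)" by (metis power_add)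
    then have "z ^ CARD('n) = ((z ^ 4)\<^sup>2) ^ 2 ^ (k - 3)" using k by (simp flip: power_mult)
    then have z: "z ^ CARD('n) = 1" "z ^ 4 \<noteq> 1" by (simp_all add: z4)
    have H: "group ?H" using SL_group(1)[OF gaussian_rationals_closed] .
    let ?N = "scalars gaussian_rationals z :: (complex^'n^'n) set"
    have N: "?N \<lhd> ?H" "closedin ?T ?N"
      by (rule scalars_normal[OF H z(1)], rule closedin_scalars[OF z(1)])
    have "\<not> minimal_group (?H Mod ?N) (quotient_group_topology ?H ?T ?N)"
      by (rule not_minimal_group_quotient_SL[OF quotient_SL_Mod[OF N] kernel_r_coset[OF N(1)] z])
    then show "\<not> totally_minimal_group ?H ?T"
      using N by (auto simp: totally_minimal_group_def)
  }
  {
    assume n: "\<nexists>k::nat. CARD('n) = 2 ^ k"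
    obtain k m where m: "odd m" "CARD('n) = 2 ^ k * m"
      by (rule odd_part[of "CARD('n)"]) auto
    have "m \<noteq> 1" using n m(2) by auto
    moreover have "m \<noteq> 0" using m(1) by (cases m) auto
    ultimately have m1: "\<not> m dvd 1" "m \<noteq> 0" by auto
    \<comment> \<open>A primitive \<open>m\<close>-th root of unity for the odd part
      \<open>m > 1\<close> of the size. Being of odd order and different from 1, it cannot satisfy
      \<open>z ^ 4 = 1\<close>.\<close>
    define z where "z = exp (2 * of_real pi * \<i> * of_nat 1 / of_nat m)"
    have zm: "z ^ m = 1" unfolding z_def by (rule complex_root_unity[OF m1(2)])
    have z1: "z \<noteq> 1" unfolding z_def using complex_root_unity_eq_1[of m 1] m1 by auto
    have zn: "z ^ CARD('n) = 1" unfolding m(2) by (simp add: mult.commute[of "2 ^ k"] power_mult zm)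
    have z4: "z ^ 4 \<noteq> 1" using power_4_odd_eq_1[OF _ zm m(1)] z1 by blast
    \<comment> \<open>A Gaussian power of \<open>z\<close> has fourth power 1 and also odd order, so
      it is 1. Hence the scalars generated by \<open>z\<close> meet \<open>H\<close> trivially, and
      the non-minimality criterion applies to \<open>H\<close> itself rather than to a proper
      quotient.\<close>
    have "z ^ l = 1" if "z ^ l \<in> gaussian_rationals" for l
    proof -
      have "(z ^ l) ^ m = 1" using zm by (metis mult.commute power_mult power_one)
      then show ?thesis
        using root_of_unity_gaussian_rationals[OF that] power_4_odd_eq_1[OF _ _ m(1)] m1(2) by simp
    qed
    moreover have "z ^ l \<in> gaussian_rationals" if "mat (z ^ l) \<in> carrier ?H" for l
    proof -
      have "(mat (z ^ l) :: complex^'n^'n) $ i $ i \<in> gaussian_rationals" for i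
        using that unfolding carrier_SL_iff by blast
      then show ?thesis by (simp add: mat_nth)
    qed
    moreover have "mat 1 \<in> carrier ?H"
      by (simp add: carrier_SL_iff mat_nth gaussian_rationals_closed)
    ultimately have "kernel ?H ?H id = scalars gaussian_rationals z"
      by (auto simp: kernel_def scalars_def one_SL mat_eq_mat_iff intro: exI[of _ 0])
    then show "\<not> minimal_group ?H ?T"
      by (rule not_minimal_group_quotient_SL[OF hausdorff_group_SL id_quotient_SL _ zn z4])
  }
qed

end
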